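(* Let $\mathbf{s2t\text{-}Gp}_A$ be the full subcategory of $\mathbf{s2t\text{-}Gp}$ on the objects $(G,\Omega,\omega_0,\omega_1)$ for which the subset $A\subseteq G$ is a subgroup of $G$, and let $\mathbf{n\text{-}Fld}$ be the full subcategory of $\mathbf{n\text{-}Dom}$ with nearfields as objects. Then the functor $K\colon\mathbf{s2t\text{-}Gp}\to\mathbf{n\text{-}Dom}$, $(G,\Omega,\omega_0,\omega_1)\mapsto(\Omega,+_0,\cdot_1)$, $(f,\Phi)\mapsto\Phi$, restricts (and corestricts) to an equivalence of categories $K_A\colon\mathbf{s2t\text{-}Gp}_A\to\mathbf{n\text{-}Fld}$.
   Context: A loop is a set with a binary operation having a two-sided identity such that for all $a,b$ the equations $ax=b$ and $ya=b$ have unique solutions $x$, $y$. A neardomain is a triple $(F,+,\cdot)$ such that: (1) $(F,+)$ is a loop with neutral element $0$; (2) for all $a,b\in F$, $a+b=0$ implies $b+a=0$; (3) $(F\setminus\{0\},\cdot)$ is a group with neutral element $1$; (4) $0\cdot a=0$ for all $a\in F$; (5) $a\cdot(b+c)=a\cdot b+a\cdot c$ for all $a,b,c\in F$; (6) for all $a,b\in F$ there is $d_{a,b}\in F\setminus\{0\}$ such that $a+(b+x)=(a+b)+d_{a,b}\cdot x$ for all $x\in F$. A neardomain is a nearfield if and only if all $d_{a,b}$ equal $1$ (in that case $(F,+)$ is a group). The category $\mathbf{n\text{-}Dom}$ has neardomains as objects; morphisms $(F,+,\cdot)\to(F',+',\cdot')$ are the maps $f\colon F\to F'$ preserving both operations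 and satisfying $f(1)=1'$. Let $G$ be a permutation group acting sharply $2$-transitively on a set $\Omega$ with $\#\Omega\ge2$ (for any ordered pairs $(\alpha_1,\alpha_2)$, $(\beta_1,\beta_2)$ with $\alpha_1\ne\alpha_2$, $\beta_1\neq\beta_2$ there is a unique $g\in G$ with $g(\alpha_i)=\beta_i$ for $i=1,2$). Let $J=\{g\in G\mid g^2=1_\Omega\ne g\}$. It is known that either all $j\in J$ are fixpoint-free, in which case one writes $\operatorname{char}G=2$, or every $j\in J$ has a unique fixpoint, in which case one writes $\operatorname{char}G\ne2$. Given a base point $\omega_0\in\Omega$, if $\operatorname{char}G\ne2$ let $\nu$ be the unique involution in $G$ fixing $\omega_0$. Put $A=J\circ\nu=\{j\circ\nu\mid j\in J\}$ if $\operatorname{char}G\neq2$ and $A=J\cup\{1_\Omega\}$ if $\operatorname{char}G=2$. It is known that $A$ contains $1_\Omega$ and acts regularly on $\Omega$ (for all $\alpha,\beta\in\Omega$ there is a unique $a\in A$ with $a(\alpha)=\beta$). The category $\mathbf{s2t\text{-}Gp}$: objects are quadruples $(G,\Omega,\omega_0,\omega_1)$ where $G$ is a permutation group acting sharply $2$-transitively on $\Omega$ ($\#\Omega\ge2$) and $\omega_0\ne\omega_1$ are base points in $\Omega$. If either both $\operatorname{char}G=\operatorname{char}H=2$ or both $\operatorname{char}G\ne2$ and $\operatorname{char}H\neq2$, a morphism $(G,\Omega,\omega_0,\omega_1)\to(H,\Sigma,\sigma_0,\sigma_1)$ is a pair $(f,\Phi)$ with $f\colon G\to H$ a group homomorphism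 and $\Phi\colon\Omega\to\Sigma$ an injective map with $\Phi(\omega_0)=\sigma_0$, $\Phi(\omega_1)=\sigma_1$ and $\Phi(g(\omega))=f(g)(\Phi(\omega))$ for all $g\in G$, $\omega\in\Omega$. If exactly one of $G,H$ has characteristic $2$, there are no morphisms. Composition is componentwise. For an object $(G,\Omega,\omega_0,\omega_1)$ define on $\Omega$: $\alpha+_0\beta=a(\beta)$, where $a\in A$ is the unique element with $a(\omega_0)=\alpha$; and $\alpha\cdot_1\beta=g(\beta)$ for $\alpha,\beta\neq\omega_0$, where $g$ is the unique element of the stabilizer $G_{\omega_0}$ with $g(\omega_1)=\alpha$, while $\alpha\cdot_1\beta=\omega_0$ if $\alpha=\omega_0$ or $\beta=\omega_0$. It is known that $(\Omega,+_0,\cdot_1)$ is a neardomain (with zero $\omega_0$ and multiplicative identity $\omega_1$). *)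

theory Defs
  imports "HOL-Algebra.Bij" "HOL-Algebra.Multiplicative_Group"
begin

section \<open>Categories, functors, equivalences\<close>

text \<open>
  The hom-sets of a category are given as a family indexed by pairs of objects and need not be
  disjoint; hence composition carries the three objects involved:
  \<open>Comp C X Y Z g f\<close> is the composite of \<open>f : X \<rightarrow> Y\<close> and \<open>g : Y \<rightarrow> Z\<close>.
\<close>

record ('o, 'm) cat =
  Obj :: "'o set"
  Hom :: "'o \<Rightarrow> 'o \<Rightarrow> 'm set"
  Ident :: "'o \<Rightarrow> 'm"
  Comp :: "'o \<Rightarrow> 'o \<Rightarrow> 'o \<Rightarrow> 'm \<Rightarrow> 'm \<Rightarrow> 'm"

locale category =
  fixes C :: "('o, 'm) cat"
  assumes Ident_in: "X \<in> Obj C \<Longrightarrow> Ident C X \<in> Hom C X X"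
    and Comp_in: "\<lbrakk>X \<in> Obj C; Y \<in> Obj C; Z \<in> Obj C; f \<in> Hom C X Y; g \<in> Hom C Y Z\<rbrakk>
      \<Longrightarrow> Comp C X Y Z g f \<in> Hom C X Z"
    and Ident_right: "\<lbrakk>X \<in> Obj C; Y \<in> Obj C; f \<in> Hom C X Y\<rbrakk>
      \<Longrightarrow> Comp C X X Y f (Ident C X) = f"
    and Ident_left: "\<lbrakk>X \<in> Obj C; Y \<in> Obj C; f \<in> Hom C X Y\<rbrakk>
      \<Longrightarrow> Comp C X Y Y (Ident C Y) f = f"
    and Comp_assoc: "\<lbrakk>W \<in> Obj C; X \<in> Obj C; Y \<in> Obj C; Z \<in> Obj C;
        f \<in> Hom C W X; g \<in> Hom C X Y; h \<in> Hom C Y Z\<rbrakk>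
      \<Longrightarrow> Comp C W Y Z h (Comp C W X Y g f) = Comp C W X Z (Comp C X Y Z h g) f"

definition full_subcat :: "('o, 'm) cat \<Rightarrow> ('o \<Rightarrow> bool) \<Rightarrow> ('o, 'm) cat"
  where "full_subcat C P = C\<lparr>Obj := {X \<in> Obj C. P X}\<rparr>"

definition iso_in :: "('o, 'm) cat \<Rightarrow> 'o \<Rightarrow> 'o \<Rightarrow> 'm \<Rightarrow> bool"
  where "iso_in C X Y f \<longleftrightarrow> f \<in> Hom C X Y \<and>
    (\<exists>g \<in> Hom C Y X. Comp C X Y X g f = Ident C X \<and> Comp C Y X Y f g = Ident C Y)"

record ('o1, 'm1, 'o2, 'm2) fctr =
  omap :: "'o1 \<Rightarrow> 'o2"
  amap :: "'o1 \<Rightarrow> 'o1 \<Rightarrow> 'm1 \<Rightarrow> 'm2"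

locale is_functor = C: category C + D: category D
  for C :: "('o1, 'm1) cat" and D :: "('o2, 'm2) cat" +
  fixes F :: "('o1, 'm1, 'o2, 'm2) fctr"
  assumes omap_in: "X \<in> Obj C \<Longrightarrow> omap F X \<in> Obj D"
    and amap_in: "\<lbrakk>X \<in> Obj C; Y \<in> Obj C; f \<in> Hom C X Y\<rbrakk>
      \<Longrightarrow> amap F X Y f \<in> Hom D (omap F X) (omap F Y)"
    and amap_Ident: "X \<in> Obj C \<Longrightarrow> amap F X X (Ident C X) = Ident D (omap F X)"
    and amap_Comp: "\<lbrakk>X \<in> Obj C; Y \<in> Obj C; Z \<in> Obj C; f \<in> Hom C X Y; g \<in> Hom C Y Z\<rbrakk>
      \<Longrightarrow> amap F X Z (Comp C X Y Z g f)
        = Comp D (omap F X) (omap F Y) (omap F Z) (amap F Y Z g) (amap F X Y f)"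

definition id_fctr :: "('o, 'm, 'o, 'm) fctr"
  where "id_fctr = \<lparr>omap = (\<lambda>X. X), amap = (\<lambda>X Y f. f)\<rparr>"

definition comp_fctr ::
    "('o2, 'm2, 'o3, 'm3) fctr \<Rightarrow> ('o1, 'm1, 'o2, 'm2) fctr \<Rightarrow> ('o1, 'm1, 'o3, 'm3) fctr"
  where "comp_fctr G F =
    \<lparr>omap = (\<lambda>X. omap G (omap F X)),
     amap = (\<lambda>X Y f. amap G (omap F X) (omap F Y) (amap F X Y f))\<rparr>"

locale natural_iso = F: is_functor C D F + G: is_functor C D G
  for C :: "('o1, 'm1) cat" and D :: "('o2, 'm2) cat"
    and F :: "('o1, 'm1, 'o2, 'm2) fctr" and G :: "('o1, 'm1, 'o2, 'm2) fctr" +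
  fixes \<eta> :: "'o1 \<Rightarrow> 'm2"
  assumes component_iso: "X \<in> Obj C \<Longrightarrow> iso_in D (omap F X) (omap G X) (\<eta> X)"
    and naturality: "\<lbrakk>X \<in> Obj C; Y \<in> Obj C; f \<in> Hom C X Y\<rbrakk>
      \<Longrightarrow> Comp D (omap F X) (omap F Y) (omap G Y) (\<eta> Y) (amap F X Y f)
        = Comp D (omap F X) (omap G X) (omap G Y) (amap G X Y f) (\<eta> X)"

definition is_equivalence ::
    "('o1, 'm1) cat \<Rightarrow> ('o2, 'm2) cat \<Rightarrow> ('o1, 'm1, 'o2, 'm2) fctr \<Rightarrow> bool"
  where "is_equivalence C D F \<longleftrightarrow> is_functor C D F \<and>
    (\<exists>G \<eta> \<epsilon>. is_functor D C G \<and>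
      natural_iso C C id_fctr (comp_fctr G F) \<eta> \<and>
      natural_iso D D (comp_fctr F G) id_fctr \<epsilon>)"


section \<open>Neardomains and nearfields\<close>

locale loop =
  fixes L (structure)
  assumes m_closed: "\<lbrakk>a \<in> carrier L; b \<in> carrier L\<rbrakk> \<Longrightarrow> a \<otimes> b \<in> carrier L"
    and one_closed: "\<one> \<in> carrier L"
    and l_one: "a \<in> carrier L \<Longrightarrow> \<one> \<otimes> a = a"
    and r_one: "a \<in> carrier L \<Longrightarrow> a \<otimes> \<one> = a"
    and l_div: "\<lbrakk>a \<in> carrier L; b \<in> carrier L\<rbrakk> \<Longrightarrow> \<exists>!x. x \<in> carrier L \<and> a \<otimes> x = b"
    and r_div: "\<lbrakk>a \<in> carrier L; b \<in> carrier L\<rbrakk> \<Longrightarrow> \<exists>!y. y \<in> carrier L \<and> y \<otimes> a = b"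

text \<open>
  The record type of rings is used for \<open>(F, +, \<cdot>)\<close>. Its fields \<open>zero\<close> and \<open>one\<close> add no information,
  being the neutral elements. The operations are required to be extensional, so that a record is
  determined by \<open>F\<close> and two maps \<open>F \<rightarrow> F \<rightarrow> F\<close>.
\<close>

locale neardomain =
  fixes R :: "'a ring" (structure)
  assumes add_map: "add R \<in> carrier R \<rightarrow>\<^sub>E carrier R \<rightarrow>\<^sub>E carrier R"
    and mult_map: "mult R \<in> carrier R \<rightarrow>\<^sub>E carrier R \<rightarrow>\<^sub>E carrier R"
    and add_loop: "loop (add_monoid R)"
    and add_zero_commute: "\<lbrakk>a \<in> carrier R; b \<in> carrier R; a \<oplus> b = \<zero>\<rbrakk> \<Longrightarrow> b \<oplus> a = \<zero>"
    and mult_group: "group (mult_of R)"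
    and zero_mult: "a \<in> carrier R \<Longrightarrow> \<zero> \<otimes> a = \<zero>"
    and distrib: "\<lbrakk>a \<in> carrier R; b \<in> carrier R; c \<in> carrier R\<rbrakk>
      \<Longrightarrow> a \<otimes> (b \<oplus> c) = a \<otimes> b \<oplus> a \<otimes> c"
    and weak_assoc: "\<lbrakk>a \<in> carrier R; b \<in> carrier R\<rbrakk>
      \<Longrightarrow> \<exists>d \<in> carrier R - {\<zero>}. \<forall>x \<in> carrier R. a \<oplus> (b \<oplus> x) = (a \<oplus> b) \<oplus> d \<otimes> x"

text \<open>
  The element \<open>d\<close> in \<open>weak_assoc\<close> is uniquely determined by \<open>a\<close> and \<open>b\<close> (take \<open>x = \<one>\<close>); a nearfield is a
  neardomain in which it always equals \<open>\<one>\<close>.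
\<close>

locale nearfield = neardomain +
  assumes d_eq_one: "\<lbrakk>a \<in> carrier R; b \<in> carrier R; d \<in> carrier R - {\<zero>};
      \<forall>x \<in> carrier R. a \<oplus> (b \<oplus> x) = (a \<oplus> b) \<oplus> d \<otimes> x\<rbrakk> \<Longrightarrow> d = \<one>"

definition n_Dom :: "('a ring, 'a \<Rightarrow> 'a) cat"
  where "n_Dom =
    \<lparr>Obj = {R. neardomain R},
     Hom = (\<lambda>R S. ring_hom R S \<inter> extensional (carrier R)),
     Ident = (\<lambda>R. \<lambda>x \<in> carrier R. x),
     Comp = (\<lambda>R S T g f. compose (carrier R) g f)\<rparr>"

definition n_Fld :: "('a ring, 'a \<Rightarrow> 'a) cat"
  where "n_Fld = full_subcat n_Dom nearfield"


section \<open>Sharply 2-transitive permutation groups\<close>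

text \<open>As in \<^const>\<open>BijGroup\<close>, permutations of \<open>\<Omega>\<close> are extensional functions.\<close>

locale s2t_group =
  fixes G :: "('a \<Rightarrow> 'a) set" and \<Omega> :: "'a set"
  assumes perm_group: "subgroup G (BijGroup \<Omega>)"
    and two_points: "\<exists>\<alpha>\<in>\<Omega>. \<exists>\<beta>\<in>\<Omega>. \<alpha> \<noteq> \<beta>"
    and sharply_two_transitive:
      "\<lbrakk>\<alpha>1 \<in> \<Omega>; \<alpha>2 \<in> \<Omega>; \<beta>1 \<in> \<Omega>; \<beta>2 \<in> \<Omega>; \<alpha>1 \<noteq> \<alpha>2; \<beta>1 \<noteq> \<beta>2\<rbrakk>
        \<Longrightarrow> \<exists>!g. g \<in> G \<and> g \<alpha>1 = \<beta>1 \<and> g \<alpha>2 = \<beta>2"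

definition grp_of :: "('a \<Rightarrow> 'a) set \<Rightarrow> 'a set \<Rightarrow> ('a \<Rightarrow> 'a) monoid"
  where "grp_of G \<Omega> = (BijGroup \<Omega>)\<lparr>carrier := G\<rparr>"

definition involutions :: "('a \<Rightarrow> 'a) set \<Rightarrow> 'a set \<Rightarrow> ('a \<Rightarrow> 'a) set"
  where "involutions G \<Omega> =
    {g \<in> G. g \<otimes>\<^bsub>BijGroup \<Omega>\<^esub> g = \<one>\<^bsub>BijGroup \<Omega>\<^esub> \<and> g \<noteq> \<one>\<^bsub>BijGroup \<Omega>\<^esub>}"

text \<open>
  For a sharply 2-transitive group the negation of the following says that every involution has a
  unique fixpoint.
\<close>

definition char2 :: "('a \<Rightarrow> 'a) set \<Rightarrow> 'a set \<Rightarrow> bool"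
  where "char2 G \<Omega> \<longleftrightarrow> (\<forall>j \<in> involutions G \<Omega>. \<forall>\<omega> \<in> \<Omega>. j \<omega> \<noteq> \<omega>)"

record 'a s2t =
  Grp :: "('a \<Rightarrow> 'a) set"
  Pts :: "'a set"
  base0 :: 'a
  base1 :: 'a

definition s2t_object :: "'a s2t \<Rightarrow> bool"
  where "s2t_object X \<longleftrightarrow> s2t_group (Grp X) (Pts X) \<and>
    base0 X \<in> Pts X \<and> base1 X \<in> Pts X \<and> base0 X \<noteq> base1 X"

definition nu :: "'a s2t \<Rightarrow> 'a \<Rightarrow> 'a"
  where "nu X = (THE j. j \<in> involutions (Grp X) (Pts X) \<and> j (base0 X) = base0 X)"

definition A_set :: "'a s2t \<Rightarrow> ('a \<Rightarrow> 'a) set"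
  where "A_set X =
    (if char2 (Grp X) (Pts X)
     then involutions (Grp X) (Pts X) \<union> {\<one>\<^bsub>BijGroup (Pts X)\<^esub>}
     else (\<lambda>j. j \<otimes>\<^bsub>BijGroup (Pts X)\<^esub> nu X) ` involutions (Grp X) (Pts X))"

definition s2t_Hom :: "'a s2t \<Rightarrow> 'a s2t \<Rightarrow> (('a \<Rightarrow> 'a) \<Rightarrow> ('a \<Rightarrow> 'a)) \<times> ('a \<Rightarrow> 'a) \<Rightarrow> bool"
  where "s2t_Hom X Y = (\<lambda>(f, \<Phi>).
    (char2 (Grp X) (Pts X) \<longleftrightarrow> char2 (Grp Y) (Pts Y)) \<and>
    f \<in> hom (grp_of (Grp X) (Pts X)) (grp_of (Grp Y) (Pts Y)) \<and> f \<in> extensional (Grp X) \<and>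
    \<Phi> \<in> Pts X \<rightarrow>\<^sub>E Pts Y \<and> inj_on \<Phi> (Pts X) \<and>
    \<Phi> (base0 X) = base0 Y \<and> \<Phi> (base1 X) = base1 Y \<and>
    (\<forall>g \<in> Grp X. \<forall>\<omega> \<in> Pts X. \<Phi> (g \<omega>) = f g (\<Phi> \<omega>)))"

definition s2t_Gp :: "('a s2t, (('a \<Rightarrow> 'a) \<Rightarrow> ('a \<Rightarrow> 'a)) \<times> ('a \<Rightarrow> 'a)) cat"
  where "s2t_Gp =
    \<lparr>Obj = {X. s2t_object X},
     Hom = (\<lambda>X Y. {p. s2t_Hom X Y p}),
     Ident = (\<lambda>X. ((\<lambda>g \<in> Grp X. g), (\<lambda>\<omega> \<in> Pts X. \<omega>))),
     Comp = (\<lambda>X Y Z (f', \<Phi>') (f, \<Phi>). (compose (Grp X) f' f, compose (Pts X) \<Phi>' \<Phi>))\<rparr>"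

definition s2t_Gp_A :: "('a s2t, (('a \<Rightarrow> 'a) \<Rightarrow> ('a \<Rightarrow> 'a)) \<times> ('a \<Rightarrow> 'a)) cat"
  where "s2t_Gp_A = full_subcat s2t_Gp (\<lambda>X. subgroup (A_set X) (grp_of (Grp X) (Pts X)))"


section \<open>The functor K\<close>

definition plus0 :: "'a s2t \<Rightarrow> 'a \<Rightarrow> 'a \<Rightarrow> 'a"
  where "plus0 X = (\<lambda>\<alpha> \<in> Pts X. \<lambda>\<beta> \<in> Pts X. (THE a. a \<in> A_set X \<and> a (base0 X) = \<alpha>) \<beta>)"

definition times1 :: "'a s2t \<Rightarrow> 'a \<Rightarrow> 'a \<Rightarrow> 'a"
  where "times1 X = (\<lambda>\<alpha> \<in> Pts X. \<lambda>\<beta> \<in> Pts X.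
    if \<alpha> = base0 X \<or> \<beta> = base0 X then base0 X
    else (THE g. g \<in> Grp X \<and> g (base0 X) = base0 X \<and> g (base1 X) = \<alpha>) \<beta>)"

definition K_functor ::
    "('a s2t, (('a \<Rightarrow> 'a) \<Rightarrow> ('a \<Rightarrow> 'a)) \<times> ('a \<Rightarrow> 'a), 'a ring, 'a \<Rightarrow> 'a) fctr"
  where "K_functor =
    \<lparr>omap = (\<lambda>X. \<lparr>carrier = Pts X, mult = times1 X, one = base1 X,
                   zero = base0 X, add = plus0 X\<rparr>),
     amap = (\<lambda>X Y (f, \<Phi>). \<Phi>)\<rparr>"

end

theory Submission
  imports Defs
begin

text \<open>
  Between the objects for which \<open>A\<close> is a subgroup and the nearfields, the functor is an isomorphism of
  categories: it is bijective on objects and on hom-sets, which is more than an equivalence requires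
  (\<open>is_equivalence_if_bijective\<close>).

  Everything about a pointed sharply 2-transitive group \<open>G\<close> is expressed through its point
  reflections: the involutions, together with the identity if the involutions have no fixpoints.
  Reflections square to the identity, are permuted by conjugation with elements of \<open>G\<close>, and form a
  regular set: exactly one of them takes \<open>\<alpha>\<close> to \<open>\<beta>\<close>. The delicate case of regularity is
  \<open>\<alpha> = \<beta>\<close> outside characteristic 2, where an involution must be determined by its fixpoint
  (\<open>involution_determined_by_fixpoint\<close>). Let \<open>\<nu>\<close> be the reflection fixing the base point. In both
  characteristics \<open>A\<close> consists of the products \<open>t \<nu>\<close> with \<open>t\<close> a reflection, so that
  \<open>\<alpha> + \<beta> = t (\<nu> \<beta>)\<close> where \<open>t\<close> takes the base point to \<open>\<alpha>\<close>. Left distributivity is the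
  invariance of the reflections and of \<open>\<nu>\<close> under conjugation by the stabilizer of the base point, and
  left multiplication by \<open>d\<^bsub>a,b\<^esub>\<close> is the element of that stabilizer by which the product of two
  elements of \<open>A\<close> differs from an element of \<open>A\<close>. If \<open>A\<close> is a subgroup, there is no difference and
  the neardomain is a nearfield.

  The permutations in \<open>G\<close> are exactly the maps \<open>x \<mapsto> a + m x\<close> with \<open>m \<noteq> 0\<close> over its neardomain
  (\<open>Grp_eq_affine\<close>). Therefore the neardomain determines the object, and a homomorphism \<open>\<Phi>\<close> of
  neardomains extends to the groups by \<open>(x \<mapsto> a + m x) \<mapsto> (x \<mapsto> \<Phi> a + \<Phi> m x)\<close> (\<open>K_full\<close>). It
  respects the characteristic, since characteristic 2 means \<open>1 + 1 = 0\<close>. The extension is unique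
  because an element of \<open>G\<close> is known from its values at the two base points.

  Conversely, the affine maps \<open>x \<mapsto> a + m x\<close> of a nearfield form a sharply 2-transitive group. Its set
  \<open>A\<close> is the group of translations (\<open>reflection_translates\<close>), so that the construction gives the
  nearfield back.
\<close>


section \<open>Isomorphisms of categories are equivalences\<close>

lemma full_subcat_simps [simp]:
  "Obj (full_subcat C P) = {X \<in> Obj C. P X}"
  "Hom (full_subcat C P) = Hom C"
  "Ident (full_subcat C P) = Ident C"
  "Comp (full_subcat C P) = Comp C"
  by (simp_all add: full_subcat_def)

lemma category_full_subcat:
  assumes "category C"
  shows "category (full_subcat C P)"
proof -
  interpret category C by fact
  show ?thesis
    by unfold_locales (simp_all add: Ident_in Comp_in Ident_right Ident_left Comp_assoc)
qed

lemma is_functor_full_subcat: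
  assumes "is_functor C D F"
    and PQ: "\<And>X. \<lbrakk>X \<in> Obj C; P X\<rbrakk> \<Longrightarrow> Q (omap F X)"
  shows "is_functor (full_subcat C P) (full_subcat D Q) F"
proof -
  interpret is_functor C D F by fact
  interpret CP: category "full_subcat C P"
    by (rule category_full_subcat) (rule C.category_axioms)
  interpret DQ: category "full_subcat D Q"
    by (rule category_full_subcat) (rule D.category_axioms)
  show ?thesis
    by unfold_locales (simp_all add: omap_in amap_in amap_Ident amap_Comp PQ)
qed

lemma (in category) iso_in_Ident: "X \<in> Obj C \<Longrightarrow> iso_in C X X (Ident C X)"
  unfolding iso_in_def by (auto intro!: Ident_in bexI[of _ "Ident C X"] Ident_left)

lemma is_functor_id: "category C \<Longrightarrow> is_functor C C id_fctr"
  by (simp add: is_functor_def is_functor_axioms_def id_fctr_def)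

lemma is_functor_comp:
  assumes "is_functor C D F" and "is_functor D E G"
  shows "is_functor C E (comp_fctr G F)"
proof -
  interpret F: is_functor C D F by fact
  interpret G: is_functor D E G by fact
  show ?thesis
    by unfold_locales
      (simp_all add: comp_fctr_def F.omap_in G.omap_in F.amap_in G.amap_in F.amap_Ident
        G.amap_Ident F.amap_Comp G.amap_Comp)
qed

text \<open>
  The inverses of the object map and of the maps on hom-sets form a functor, because \<open>F\<close> reflects
  equations between morphisms. Both composites are identity functors on the nose, so identity
  morphisms serve as the components of the two natural isomorphisms.
\<close>

lemma is_equivalence_if_bijective:
  assumes F: "is_functor C D F"
    and bij_obj: "bij_betw (omap F) (Obj C) (Obj D)"
    and bij_hom: "\<And>X Y. \<lbrakk>X \<in> Obj C; Y \<in> Obj C\<rbrakk>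
      \<Longrightarrow> bij_betw (amap F X Y) (Hom C X Y) (Hom D (omap F X) (omap F Y))"
  shows "is_equivalence C D F"
proof -
  interpret is_functor C D F by (rule F)
  define o' where "o' = inv_into (Obj C) (omap F)"
  define a' where "a' U V = inv_into (Hom C (o' U) (o' V)) (amap F (o' U) (o' V))" for U V
  define G where "G = \<lparr>omap = o', amap = a'\<rparr>"
  have o'_in: "o' U \<in> Obj C" and Fo': "omap F (o' U) = U" if "U \<in> Obj D" for U
    using that bij_obj unfolding o'_def bij_betw_def by (auto intro: inv_into_into f_inv_into_f)
  have o'F: "o' (omap F X) = X" if "X \<in> Obj C" for X
    using that bij_obj unfolding o'_def bij_betw_def by auto
  have bij': "bij_betw (amap F (o' U) (o' V)) (Hom C (o' U) (o' V)) (Hom D U V)"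
    if "U \<in> Obj D" "V \<in> Obj D" for U V
    using bij_hom[of "o' U" "o' V"] that by (simp add: o'_in Fo')
  have a'_in: "a' U V u \<in> Hom C (o' U) (o' V)" and Fa': "amap F (o' U) (o' V) (a' U V u) = u"
    if "U \<in> Obj D" "V \<in> Obj D" "u \<in> Hom D U V" for U V u
    using bij'[of U V] that unfolding a'_def bij_betw_def
    by (auto intro: inv_into_into f_inv_into_f)
  have F_inj: "f = g"
    if "X \<in> Obj C" "Y \<in> Obj C" "f \<in> Hom C X Y" "g \<in> Hom C X Y" "amap F X Y f = amap F X Y g"
    for X Y f g
    using bij_hom[of X Y] that unfolding bij_betw_def inj_on_def by auto
  have a'F: "a' (omap F X) (omap F Y) (amap F X Y f) = f"
    if "X \<in> Obj C" "Y \<in> Obj C" "f \<in> Hom C X Y" for X Y f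
    using bij_hom[of X Y] that unfolding a'_def by (simp add: o'F bij_betw_def)
  have G: "is_functor D C G"
  proof
    fix U assume U: "U \<in> Obj D"
    then show "omap G U \<in> Obj C" by (simp add: G_def o'_in)
    have "a' U U (Ident D U) = Ident C (o' U)"
      using U by (intro F_inj[of "o' U" "o' U"])
        (simp_all add: o'_in a'_in D.Ident_in C.Ident_in Fa' amap_Ident Fo')
    then show "amap G U U (Ident D U) = Ident C (omap G U)" by (simp add: G_def)
  next
    fix U V u assume "U \<in> Obj D" "V \<in> Obj D" "u \<in> Hom D U V"
    then show "amap G U V u \<in> Hom C (omap G U) (omap G V)" by (simp add: G_def a'_in)
  next
    fix U V W u v
    assume UVW: "U \<in> Obj D" "V \<in> Obj D" "W \<in> Obj D" "u \<in> Hom D U V" "v \<in> Hom D V W"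
    have "a' U W (Comp D U V W v u) = Comp C (o' U) (o' V) (o' W) (a' V W v) (a' U V u)"
      using UVW D.Comp_in[OF UVW] C.Comp_in[of "o' U" "o' V" "o' W" "a' U V u" "a' V W v"]
      by (intro F_inj[of "o' U" "o' W"]) (simp_all add: o'_in a'_in Fa' amap_Comp Fo')
    then show "amap G U W (Comp D U V W v u)
        = Comp C (omap G U) (omap G V) (omap G W) (amap G V W v) (amap G U V u)"
      by (simp add: G_def)
  qed
  have "natural_iso C C id_fctr (comp_fctr G F) (Ident C)"
    using is_functor_id[OF C.category_axioms] is_functor_comp[OF F G]
    by (simp add: natural_iso_def natural_iso_axioms_def id_fctr_def comp_fctr_def G_def o'F a'F
        C.iso_in_Ident C.Ident_left C.Ident_right)
  moreover have "natural_iso D D (comp_fctr F G) id_fctr (Ident D)"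
    using is_functor_id[OF D.category_axioms] is_functor_comp[OF G F]
    by (simp add: natural_iso_def natural_iso_axioms_def id_fctr_def comp_fctr_def G_def Fo' Fa'
        D.iso_in_Ident D.Ident_left D.Ident_right)
  ultimately show ?thesis
    unfolding is_equivalence_def using F G by blast
qed


section \<open>The two categories\<close>

lemma n_Dom_simps [simp]:
  "Obj n_Dom = {R. neardomain R}"
  "Hom n_Dom = (\<lambda>R S. ring_hom R S \<inter> extensional (carrier R))"
  "Ident n_Dom = (\<lambda>R. \<lambda>x \<in> carrier R. x)"
  "Comp n_Dom = (\<lambda>R S T g f. compose (carrier R) g f)"
  by (simp_all add: n_Dom_def)

lemma s2t_Gp_simps [simp]:
  "Obj s2t_Gp = {X. s2t_object X}"
  "Hom s2t_Gp = (\<lambda>X Y. {p. s2t_Hom X Y p})"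
  "Ident s2t_Gp = (\<lambda>X. ((\<lambda>g \<in> Grp X. g), (\<lambda>\<omega> \<in> Pts X. \<omega>)))"
  "Comp s2t_Gp = (\<lambda>X Y Z (f', \<Phi>') (f, \<Phi>). (compose (Grp X) f' f, compose (Pts X) \<Phi>' \<Phi>))"
  by (simp_all add: s2t_Gp_def)

context neardomain
begin

lemma add_closed: "\<lbrakk>a \<in> carrier R; b \<in> carrier R\<rbrakk> \<Longrightarrow> a \<oplus> b \<in> carrier R"
  using loop.m_closed[OF add_loop] by simp

lemma zero_closed: "\<zero> \<in> carrier R"
  using loop.one_closed[OF add_loop] by simp

lemma l_zero: "a \<in> carrier R \<Longrightarrow> \<zero> \<oplus> a = a"
  using loop.l_one[OF add_loop] by simp

lemma r_zero: "a \<in> carrier R \<Longrightarrow> a \<oplus> \<zero> = a"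
  using loop.r_one[OF add_loop] by simp

lemma add_solve: "\<lbrakk>a \<in> carrier R; b \<in> carrier R\<rbrakk> \<Longrightarrow> \<exists>x \<in> carrier R. a \<oplus> x = b"
  using loop.l_div[OF add_loop, of a b] by auto

lemma add_cancel:
  "\<lbrakk>a \<in> carrier R; x \<in> carrier R; y \<in> carrier R; a \<oplus> x = a \<oplus> y\<rbrakk> \<Longrightarrow> x = y"
  using loop.l_div[OF add_loop, of a "a \<oplus> x"] add_closed by auto

lemma add_cancel_right:
  "\<lbrakk>a \<in> carrier R; x \<in> carrier R; y \<in> carrier R; x \<oplus> a = y \<oplus> a\<rbrakk> \<Longrightarrow> x = y"
  using loop.r_div[OF add_loop, of a "x \<oplus> a"] add_closed by auto

lemma one_closed: "\<one> \<in> carrier R" and one_not_zero: "\<one> \<noteq> \<zero>"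
  using monoid.one_closed[OF group.is_monoid[OF mult_group]] by auto

lemma mult_closed: "\<lbrakk>a \<in> carrier R; b \<in> carrier R\<rbrakk> \<Longrightarrow> a \<otimes> b \<in> carrier R"
  using mult_map by (auto simp: PiE_def Pi_def)

lemma mult_zero:
  assumes "a \<in> carrier R"
  shows "a \<otimes> \<zero> = \<zero>"
proof (rule add_cancel)
  show "a \<otimes> \<zero> \<oplus> a \<otimes> \<zero> = a \<otimes> \<zero> \<oplus> \<zero>"
    using distrib[OF assms zero_closed zero_closed] assms
    by (simp add: l_zero r_zero mult_closed zero_closed)
qed (use assms in \<open>simp_all add: mult_closed zero_closed\<close>)

lemma mult_assoc:
  assumes "a \<in> carrier R" "b \<in> carrier R" "c \<in> carrier R"
  shows "(a \<otimes> b) \<otimes> c = a \<otimes> (b \<otimes> c)"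
proof (cases "a = \<zero> \<or> b = \<zero> \<or> c = \<zero>")
  case True
  then show ?thesis using assms by (auto simp: zero_mult mult_zero mult_closed)
next
  case False
  then show ?thesis
    using monoid.m_assoc[OF group.is_monoid[OF mult_group], of a b c] assms by simp
qed

lemma one_mult: "a \<in> carrier R \<Longrightarrow> \<one> \<otimes> a = a"
  using monoid.l_one[OF group.is_monoid[OF mult_group], of a] by (cases "a = \<zero>")
    (auto simp: mult_zero one_closed)

lemma mult_one: "a \<in> carrier R \<Longrightarrow> a \<otimes> \<one> = a"
  using monoid.r_one[OF group.is_monoid[OF mult_group], of a] by (cases "a = \<zero>")
    (auto simp: zero_mult one_closed)

lemma mult_nonzero:
  "\<lbrakk>a \<in> carrier R; b \<in> carrier R; a \<noteq> \<zero>; b \<noteq> \<zero>\<rbrakk> \<Longrightarrow> a \<otimes> b \<noteq> \<zero>"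
  using monoid.m_closed[OF group.is_monoid[OF mult_group], of a b] by auto

lemma mult_inverse:
  assumes "a \<in> carrier R" "a \<noteq> \<zero>"
  obtains b where "b \<in> carrier R" "b \<noteq> \<zero>" "a \<otimes> b = \<one>" "b \<otimes> a = \<one>"
  using group.r_inv[OF mult_group, of a] group.l_inv[OF mult_group, of a]
    group.inv_closed[OF mult_group, of a] assms by auto

text \<open>A homomorphism of neardomains preserves \<open>\<zero>\<close>, the only additive idempotent, and sends units
  to units; solving \<open>a \<oplus> x = b\<close> with \<open>x \<noteq> \<zero>\<close> shows that it separates distinct points.\<close>

lemma hom_zero:
  assumes S: "neardomain S" and h: "h \<in> ring_hom R S"
  shows "h \<zero> = \<zero>\<^bsub>S\<^esub>"
proof -
  interpret S: neardomain S by (rule S)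
  have c: "h \<zero> \<in> carrier S" using ring_hom_closed[OF h] zero_closed by simp
  have "h \<zero> \<oplus>\<^bsub>S\<^esub> h \<zero> = h \<zero> \<oplus>\<^bsub>S\<^esub> \<zero>\<^bsub>S\<^esub>"
    using ring_hom_add[OF h zero_closed zero_closed] c by (simp add: l_zero zero_closed S.r_zero)
  then show ?thesis using S.add_cancel c S.zero_closed by blast
qed

lemma hom_nonzero:
  assumes S: "neardomain S" and h: "h \<in> ring_hom R S" and a: "a \<in> carrier R" "a \<noteq> \<zero>"
  shows "h a \<noteq> \<zero>\<^bsub>S\<^esub>"
proof
  interpret S: neardomain S by (rule S)
  assume "h a = \<zero>\<^bsub>S\<^esub>"
  moreover obtain b where "b \<in> carrier R" "a \<otimes> b = \<one>" using mult_inverse[OF a] .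
  ultimately have "\<one>\<^bsub>S\<^esub> = \<zero>\<^bsub>S\<^esub>"
    using ring_hom_mult[OF h a(1), of b] ring_hom_one[OF h] ring_hom_closed[OF h, of b]
    by (simp add: S.zero_mult)
  then show False using S.one_not_zero by simp
qed

lemma hom_inj_on:
  assumes S: "neardomain S" and h: "h \<in> ring_hom R S"
  shows "inj_on h (carrier R)"
proof (rule inj_onI)
  interpret S: neardomain S by (rule S)
  fix a b assume ab: "a \<in> carrier R" "b \<in> carrier R" "h a = h b"
  obtain x where x: "x \<in> carrier R" "a \<oplus> x = b" using add_solve ab by blast
  have "h a \<oplus>\<^bsub>S\<^esub> h x = h a \<oplus>\<^bsub>S\<^esub> \<zero>\<^bsub>S\<^esub>"
    using ring_hom_add[OF h ab(1) x(1)] x ab ring_hom_closed[OF h] by (simp add: S.r_zero)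
  then have "h x = \<zero>\<^bsub>S\<^esub>"
    using S.add_cancel ring_hom_closed[OF h] ab x S.zero_closed by blast
  then have "x = \<zero>" using hom_nonzero[OF S h x(1)] by blast
  then show "a = b" using x ab by (simp add: r_zero)
qed

end

lemma category_n_Dom: "category (n_Dom :: ('a ring, _) cat)"
proof
  fix X Y :: "'a ring" and f assume "f \<in> Hom n_Dom X Y"
  then have f: "f \<in> extensional (carrier X)" "f \<in> carrier X \<rightarrow> carrier Y"
    by (auto simp: ring_hom_def)
  show "Comp n_Dom X X Y f (Ident n_Dom X) = f"
    using f by (auto simp: compose_def extensional_def)
  show "Comp n_Dom X Y Y (Ident n_Dom Y) f = f"
    using f by (auto simp: compose_def extensional_def Pi_def)
next
  fix X :: "'a ring" assume "X \<in> Obj n_Dom"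
  then interpret neardomain X by simp
  show "Ident n_Dom X \<in> Hom n_Dom X X"
    by (auto simp: ring_hom_def add_closed mult_closed one_closed)
next
  fix X Y Z :: "'a ring" and f g
  assume "X \<in> Obj n_Dom" and fg: "f \<in> Hom n_Dom X Y" "g \<in> Hom n_Dom Y Z"
  then interpret neardomain X by simp
  show "Comp n_Dom X Y Z g f \<in> Hom n_Dom X Z"
    using fg by (auto simp: ring_hom_def compose_def Pi_def add_closed mult_closed one_closed)
next
  fix W X Y Z :: "'a ring" and f g h
  assume "f \<in> Hom n_Dom W X"
  then show "Comp n_Dom W Y Z h (Comp n_Dom W X Y g f) = Comp n_Dom W X Z (Comp n_Dom X Y Z h g) f"
    by (auto simp: ring_hom_def compose_def Pi_def)
qed


section \<open>Involutions of a sharply 2-transitive group\<close>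

context s2t_group
begin

lemma Bij: "g \<in> G \<Longrightarrow> g \<in> Bij \<Omega>"
  using subgroup.subset[OF perm_group] by (auto simp: BijGroup_def)

lemma bij_betw: "g \<in> G \<Longrightarrow> bij_betw g \<Omega> \<Omega>"
  using Bij by (auto simp: Bij_def)

lemma closed: "\<lbrakk>g \<in> G; \<omega> \<in> \<Omega>\<rbrakk> \<Longrightarrow> g \<omega> \<in> \<Omega>"
  using bij_betw bij_betwE by blast

lemma inj: "\<lbrakk>g \<in> G; \<alpha> \<in> \<Omega>; \<beta> \<in> \<Omega>; g \<alpha> = g \<beta>\<rbrakk> \<Longrightarrow> \<alpha> = \<beta>"
  using bij_betw unfolding bij_betw_def inj_on_def by blast

lemma ext: "\<lbrakk>g \<in> G; h \<in> G; \<And>\<omega>. \<omega> \<in> \<Omega> \<Longrightarrow> g \<omega> = h \<omega>\<rbrakk> \<Longrightarrow> g = h"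
  using Bij by (auto simp: Bij_def intro: extensionalityI)

lemma mult_eq: "\<lbrakk>g \<in> G; h \<in> G\<rbrakk> \<Longrightarrow> g \<otimes>\<^bsub>BijGroup \<Omega>\<^esub> h = compose \<Omega> g h"
  using Bij by (simp add: BijGroup_def)

lemma one_eq: "\<one>\<^bsub>BijGroup \<Omega>\<^esub> = (\<lambda>\<omega> \<in> \<Omega>. \<omega>)"
  by (simp add: BijGroup_def)

lemma compose_in: "\<lbrakk>g \<in> G; h \<in> G\<rbrakk> \<Longrightarrow> compose \<Omega> g h \<in> G"
  using subgroup.m_closed[OF perm_group] by (simp add: mult_eq)

lemma id_in: "(\<lambda>\<omega> \<in> \<Omega>. \<omega>) \<in> G"
  using subgroup.one_closed[OF perm_group] by (simp add: one_eq)

lemma inverse: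
  assumes "g \<in> G"
  obtains g' where "g' \<in> G" "\<And>\<omega>. \<omega> \<in> \<Omega> \<Longrightarrow> g' (g \<omega>) = \<omega>" "\<And>\<omega>. \<omega> \<in> \<Omega> \<Longrightarrow> g (g' \<omega>) = \<omega>"
proof
  interpret B: group "BijGroup \<Omega>" by (rule group_BijGroup)
  let ?g' = "inv\<^bsub>BijGroup \<Omega>\<^esub> g"
  show g': "?g' \<in> G" using subgroup.m_inv_closed[OF perm_group assms] .
  have "g \<in> carrier (BijGroup \<Omega>)" using subgroup.subset[OF perm_group] assms by auto
  then have "compose \<Omega> ?g' g = (\<lambda>\<omega> \<in> \<Omega>. \<omega>)" "compose \<Omega> g ?g' = (\<lambda>\<omega> \<in> \<Omega>. \<omega>)"
    using B.l_inv[of g] B.r_inv[of g] assms g' by (simp_all add: mult_eq one_eq)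
  then show "?g' (g \<omega>) = \<omega>" "g (?g' \<omega>) = \<omega>" if "\<omega> \<in> \<Omega>" for \<omega>
    using that by (metis compose_eq restrict_apply')+
qed

lemma two_transitive:
  assumes "\<alpha>1 \<in> \<Omega>" "\<alpha>2 \<in> \<Omega>" "\<beta>1 \<in> \<Omega>" "\<beta>2 \<in> \<Omega>" "\<alpha>1 \<noteq> \<alpha>2" "\<beta>1 \<noteq> \<beta>2"
  obtains g where "g \<in> G" "g \<alpha>1 = \<beta>1" "g \<alpha>2 = \<beta>2"
  using sharply_two_transitive[OF assms] by auto

lemma eq_if_agree:
  assumes "g \<in> G" "h \<in> G" "\<alpha> \<in> \<Omega>" "\<beta> \<in> \<Omega>" "\<alpha> \<noteq> \<beta>" "g \<alpha> = h \<alpha>" "g \<beta> = h \<beta>"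
  shows "g = h"
proof -
  have "h \<alpha> \<noteq> h \<beta>" using inj assms by blast
  then show ?thesis
    using sharply_two_transitive[of \<alpha> \<beta> "h \<alpha>" "h \<beta>"] assms closed by blast
qed

lemma other_point: "\<exists>\<beta>\<in>\<Omega>. \<beta> \<noteq> \<alpha>"
  using two_points by metis

lemma transitive:
  assumes "\<alpha> \<in> \<Omega>" "\<beta> \<in> \<Omega>"
  obtains g where "g \<in> G" "g \<alpha> = \<beta>"
  using other_point two_transitive assms by metis

abbreviation J where "J \<equiv> involutions G \<Omega>"

lemma involution_iff:
  "j \<in> J \<longleftrightarrow> j \<in> G \<and> (\<forall>\<omega>\<in>\<Omega>. j (j \<omega>) = \<omega>) \<and> (\<exists>\<omega>\<in>\<Omega>. j \<omega> \<noteq> \<omega>)"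
proof (cases "j \<in> G")
  case True
  have "compose \<Omega> j j = (\<lambda>\<omega>\<in>\<Omega>. \<omega>) \<longleftrightarrow> (\<forall>\<omega>\<in>\<Omega>. j (j \<omega>) = \<omega>)"
    by (auto simp: compose_def fun_eq_iff)
  moreover have "j \<noteq> (\<lambda>\<omega>\<in>\<Omega>. \<omega>) \<longleftrightarrow> (\<exists>\<omega>\<in>\<Omega>. j \<omega> \<noteq> \<omega>)"
    using ext[OF True id_in] by auto
  ultimately show ?thesis using True by (simp add: involutions_def mult_eq one_eq)
qed (simp add: involutions_def)

text \<open>The square of an element swapping two points fixes both of them.\<close>

lemma involution_swapping:
  assumes "\<alpha> \<in> \<Omega>" "\<beta> \<in> \<Omega>" "\<alpha> \<noteq> \<beta>"
  obtains j where "j \<in> J" "j \<alpha> = \<beta>" "j \<beta> = \<alpha>"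
proof -
  obtain j where j: "j \<in> G" "j \<alpha> = \<beta>" "j \<beta> = \<alpha>"
    using two_transitive assms by metis
  have "compose \<Omega> j j = (\<lambda>\<omega>\<in>\<Omega>. \<omega>)"
    using j assms by (intro eq_if_agree[of _ _ \<alpha> \<beta>]) (auto simp: compose_in id_in compose_eq)
  then have "j (j \<omega>) = \<omega>" if "\<omega> \<in> \<Omega>" for \<omega>
    using that by (metis compose_eq restrict_apply')
  then have "j \<in> J" unfolding involution_iff using j assms by metis
  then show ?thesis using that j by blast
qed

lemma involution_eq:
  assumes "i \<in> J" "j \<in> J" "\<alpha> \<in> \<Omega>" "i \<alpha> = j \<alpha>" "j \<alpha> \<noteq> \<alpha>"
  shows "i = j"
proof (rule eq_if_agree)
  show "i (j \<alpha>) = j (j \<alpha>)" using assms by (metis involution_iff)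
qed (use assms in \<open>auto simp: involution_iff closed\<close>)

lemma involution_conjugate:
  assumes j: "j \<in> J" and k: "k \<in> G" and g: "g \<in> G"
    and kg: "\<And>\<omega>. \<omega> \<in> \<Omega> \<Longrightarrow> k (g \<omega>) = g (j \<omega>)"
  shows "k \<in> J"
proof -
  obtain g' where g': "g' \<in> G" "\<And>\<omega>. \<omega> \<in> \<Omega> \<Longrightarrow> g (g' \<omega>) = \<omega>" using inverse[OF g] by metis
  have "k (k \<omega>) = \<omega>" if "\<omega> \<in> \<Omega>" for \<omega>
  proof -
    have "k (k (g (g' \<omega>))) = g (j (j (g' \<omega>)))"
      using kg[of "g' \<omega>"] kg[of "j (g' \<omega>)"] that closed g'(1) j by (simp add: involution_iff)
    then show ?thesis using that g' j closed[OF g'(1)] by (simp add: involution_iff)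
  qed
  moreover obtain \<alpha> where \<alpha>: "\<alpha> \<in> \<Omega>" "j \<alpha> \<noteq> \<alpha>" using j by (auto simp: involution_iff)
  then have "k (g \<alpha>) \<noteq> g \<alpha>" using kg inj[OF g] closed j by (metis involution_iff)
  ultimately show ?thesis using k \<alpha> g closed by (auto simp: involution_iff)
qed

text \<open>The element taking a pair swapped by \<open>i\<close> to a pair swapped by \<open>j\<close> conjugates \<open>i\<close> to \<open>j\<close>.\<close>

lemma involutions_conjugate:
  assumes i: "i \<in> J" and j: "j \<in> J" and g: "g \<in> G"
    and \<alpha>: "\<alpha> \<in> \<Omega>" "i \<alpha> \<noteq> \<alpha>" and g1: "g (i \<alpha>) = j (g \<alpha>)"
    and \<omega>: "\<omega> \<in> \<Omega>"
  shows "j (g \<omega>) = g (i \<omega>)"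
proof -
  have "compose \<Omega> j g = compose \<Omega> g i"
    using assms by (intro eq_if_agree[of _ _ \<alpha> "i \<alpha>"])
      (auto simp: compose_in compose_eq involution_iff closed)
  then show ?thesis using \<omega> by (metis compose_eq)
qed

text \<open>All involutions are conjugate, so they have fixpoints as soon as one of them does.\<close>

lemma fixpoint_exists:
  assumes c: "\<not> char2 G \<Omega>" and j: "j \<in> J"
  obtains \<omega> where "\<omega> \<in> \<Omega>" "j \<omega> = \<omega>"
proof -
  obtain i \<omega> where i: "i \<in> J" "\<omega> \<in> \<Omega>" "i \<omega> = \<omega>" using c by (auto simp: char2_def)
  obtain \<alpha> \<beta> where a: "\<alpha> \<in> \<Omega>" "i \<alpha> \<noteq> \<alpha>" and b: "\<beta> \<in> \<Omega>" "j \<beta> \<noteq> \<beta>"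
    using i j by (auto simp: involution_iff)
  obtain g where g: "g \<in> G" "g \<alpha> = \<beta>" "g (i \<alpha>) = j \<beta>"
    using two_transitive[of \<alpha> "i \<alpha>" \<beta> "j \<beta>"] a b i j closed by (metis involution_iff)
  have "j (g \<omega>) = g \<omega>" using involutions_conjugate[OF i(1) j g(1) a _ i(2)] g i by simp
  then show ?thesis using that closed g i by blast
qed

lemma fixpoint_unique:
  assumes "j \<in> J" "\<alpha> \<in> \<Omega>" "\<beta> \<in> \<Omega>" "j \<alpha> = \<alpha>" "j \<beta> = \<beta>"
  shows "\<alpha> = \<beta>"
proof (rule ccontr)
  assume "\<alpha> \<noteq> \<beta>"
  then have "j = (\<lambda>\<omega>\<in>\<Omega>. \<omega>)"
    using assms by (intro eq_if_agree[of _ _ \<alpha> \<beta>]) (auto simp: involution_iff id_in)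
  then show False using assms by (auto simp: involution_iff)
qed

text \<open>
  Let \<open>i\<close> and \<open>j\<close> fix \<open>\<omega>\<close> and move \<open>\<alpha>\<close>. The element fixing \<open>\<alpha>\<close> and taking \<open>i \<alpha>\<close> to \<open>j \<alpha>\<close> conjugates
  \<open>i\<close> to \<open>j\<close>, so it takes the fixpoint of \<open>i\<close> to that of \<open>j\<close>. It therefore fixes \<open>\<omega>\<close> as well as \<open>\<alpha>\<close>
  and is trivial.
\<close>

lemma involution_determined_by_fixpoint:
  assumes i: "i \<in> J" and j: "j \<in> J" and \<omega>: "\<omega> \<in> \<Omega>" "i \<omega> = \<omega>" "j \<omega> = \<omega>"
  shows "i = j"
proof -
  obtain \<alpha> where a: "\<alpha> \<in> \<Omega>" "\<alpha> \<noteq> \<omega>" using other_point by metis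
  have ij: "i \<alpha> \<noteq> \<alpha>" "j \<alpha> \<noteq> \<alpha>" using fixpoint_unique i j \<omega> a by blast+
  have G: "i \<in> G" "j \<in> G" using i j by (auto simp: involution_iff)
  obtain g where g: "g \<in> G" "g \<alpha> = \<alpha>" "g (i \<alpha>) = j \<alpha>"
    using two_transitive[of \<alpha> "i \<alpha>" \<alpha> "j \<alpha>"] a G ij closed by metis
  have "j (g \<omega>) = g \<omega>" using involutions_conjugate[OF i j g(1) a(1) ij(1) _ \<omega>(1)] g \<omega> by simp
  then have "g \<omega> = \<omega>" using fixpoint_unique[OF j] closed g(1) \<omega> by blast
  then have "g = (\<lambda>\<omega>\<in>\<Omega>. \<omega>)"
    using g a \<omega> by (intro eq_if_agree[of _ _ \<alpha> \<omega>]) (auto simp: id_in)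
  then have "i \<alpha> = j \<alpha>" using g closed G a by simp
  then show ?thesis using involution_eq i j a ij by blast
qed

text \<open>
  Adjoining the identity exactly when the involutions have no fixpoints makes the point reflections
  regular on \<open>\<Omega>\<close> in every characteristic. Uniformly, \<open>A\<close> arises from them by composing with the
  reflection in the base point.
\<close>

definition reflections :: "('a \<Rightarrow> 'a) set"
  where "reflections = (if char2 G \<Omega> then J \<union> {\<lambda>\<omega>\<in>\<Omega>. \<omega>} else J)"

lemma reflection_in: "t \<in> reflections \<Longrightarrow> t \<in> G"
  by (auto simp: reflections_def involution_iff id_in split: if_splits)

lemma reflection_twice: "\<lbrakk>t \<in> reflections; \<omega> \<in> \<Omega>\<rbrakk> \<Longrightarrow> t (t \<omega>) = \<omega>"
  by (auto simp: reflections_def involution_iff split: if_splits)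

lemma reflection_conjugate:
  assumes t: "t \<in> reflections" and k: "k \<in> G" and g: "g \<in> G"
    and kg: "\<And>\<omega>. \<omega> \<in> \<Omega> \<Longrightarrow> k (g \<omega>) = g (t \<omega>)"
  shows "k \<in> reflections"
proof (cases "t \<in> J")
  case True
  then show ?thesis using involution_conjugate[OF _ k g kg] by (auto simp: reflections_def)
next
  case False
  then have c: "char2 G \<Omega>" and t: "t = (\<lambda>\<omega>\<in>\<Omega>. \<omega>)"
    using t by (auto simp: reflections_def split: if_splits)
  have "k = t"
  proof (rule ext)
    fix \<omega> assume \<omega>: "\<omega> \<in> \<Omega>"
    obtain g' where "g' \<in> G" "g (g' \<omega>) = \<omega>" using inverse[OF g] \<omega> by metis
    then show "k \<omega> = t \<omega>" using kg[of "g' \<omega>"] \<omega> closed[of g' \<omega>] by (simp add: t)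
  qed (use k t id_in in auto)
  then show ?thesis using c t by (simp add: reflections_def)
qed

lemma reflection_conjugate_exists:
  assumes t: "t \<in> reflections" and g: "g \<in> G"
  obtains k where "k \<in> reflections" "\<And>\<omega>. \<omega> \<in> \<Omega> \<Longrightarrow> k (g \<omega>) = g (t \<omega>)"
proof -
  obtain g' where g': "g' \<in> G" "\<And>\<omega>. \<omega> \<in> \<Omega> \<Longrightarrow> g' (g \<omega>) = \<omega>" using inverse[OF g] by metis
  let ?k = "compose \<Omega> g (compose \<Omega> t g')"
  have "?k \<in> G" using g g' reflection_in[OF t] by (simp add: compose_in)
  moreover have kg: "?k (g x) = g (t x)" if "x \<in> \<Omega>" for x
    using that closed[OF g] closed[OF g'(1)] g'(2) by (simp add: compose_eq)
  ultimately show ?thesis using that[of ?k] reflection_conjugate[OF t _ g] by blast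
qed

lemma reflection_eq:
  assumes "s \<in> reflections" "t \<in> reflections" "\<alpha> \<in> \<Omega>" "s \<alpha> = t \<alpha>"
  shows "s = t"
proof (cases "char2 G \<Omega>")
  case True
  then have "j \<alpha> \<noteq> \<alpha>" if "j \<in> J" for j using that assms(3) by (auto simp: char2_def)
  note s = this[of s] and t = this[of t]
  show ?thesis
    using assms True involution_eq[of s t \<alpha>] s t by (auto simp: reflections_def)
next
  case False
  then show ?thesis
    using assms involution_eq[of s t \<alpha>] involution_determined_by_fixpoint[of s t \<alpha>]
    by (cases "t \<alpha> = \<alpha>") (auto simp: reflections_def)
qed

text \<open>Outside characteristic 2, conjugating an involution moves its fixpoint to any given point.\<close>

lemma reflection_exists:
  assumes "\<alpha> \<in> \<Omega>" "\<beta> \<in> \<Omega>"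
  obtains t where "t \<in> reflections" "t \<alpha> = \<beta>"
proof (cases "\<alpha> = \<beta>")
  case False
  then show ?thesis
    using involution_swapping[OF assms] that by (metis UnI1 reflections_def)
next
  case True
  show ?thesis
  proof (cases "char2 G \<Omega>")
    case c: True
    then show ?thesis using that[of "\<lambda>\<omega>\<in>\<Omega>. \<omega>"] True assms by (simp add: reflections_def)
  next
    case c: False
    obtain \<gamma> where "\<gamma> \<in> \<Omega>" "\<gamma> \<noteq> \<alpha>" using other_point by metis
    then obtain i where i: "i \<in> J" using involution_swapping assms by metis
    then obtain \<omega> where \<omega>: "\<omega> \<in> \<Omega>" "i \<omega> = \<omega>" using fixpoint_exists[OF c] by metis
    obtain g where g: "g \<in> G" "g \<omega> = \<alpha>" using transitive \<omega> assms by metis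
    have "i \<in> reflections" using i c by (simp add: reflections_def)
    then obtain k where "k \<in> reflections" "\<And>x. x \<in> \<Omega> \<Longrightarrow> k (g x) = g (i x)"
      using reflection_conjugate_exists[OF _ g(1)] by metis
    then show ?thesis using that[of k] True \<omega> g by metis
  qed
qed

end

section \<open>The neardomain of a pointed sharply 2-transitive group\<close>

locale pointed_s2t =
  fixes X :: "'a s2t"
  assumes object: "s2t_object X"

sublocale pointed_s2t \<subseteq> s2t_group "Grp X" "Pts X"
  using object by (simp add: s2t_object_def)

context pointed_s2t
begin

abbreviation "G \<equiv> Grp X"
abbreviation "\<Omega> \<equiv> Pts X"
abbreviation "o0 \<equiv> base0 X"
abbreviation "o1 \<equiv> base1 X"

lemma base: "o0 \<in> \<Omega>" "o1 \<in> \<Omega>" "o0 \<noteq> o1"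
  using object by (auto simp: s2t_object_def)

definition \<nu> where "\<nu> = (THE t. t \<in> reflections \<and> t o0 = o0)"

lemma \<nu>: "\<nu> \<in> reflections" "\<nu> o0 = o0"
proof -
  have "\<exists>!t. t \<in> reflections \<and> t o0 = o0"
    using reflection_exists[OF base(1) base(1)] reflection_eq base(1) by metis
  from theI'[OF this] show "\<nu> \<in> reflections" "\<nu> o0 = o0" by (simp_all add: \<nu>_def)
qed

lemma \<nu>_unique: "\<lbrakk>t \<in> reflections; t o0 = o0\<rbrakk> \<Longrightarrow> t = \<nu>"
  using reflection_eq \<nu> base by metis

lemma \<nu>_in: "\<nu> \<in> G"
  using \<nu> reflection_in by blast

lemma \<nu>_twice: "\<omega> \<in> \<Omega> \<Longrightarrow> \<nu> (\<nu> \<omega>) = \<omega>"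
  using \<nu> reflection_twice by blast

lemma \<nu>_commute:
  assumes g: "g \<in> G" "g o0 = o0" and \<omega>: "\<omega> \<in> \<Omega>"
  shows "g (\<nu> \<omega>) = \<nu> (g \<omega>)"
proof -
  obtain k where k: "k \<in> reflections" "\<And>\<omega>. \<omega> \<in> \<Omega> \<Longrightarrow> k (g \<omega>) = g (\<nu> \<omega>)"
    using reflection_conjugate_exists[OF \<nu>(1) g(1)] by metis
  then have "k o0 = o0" using k(2)[OF base(1)] g \<nu> by simp
  then show ?thesis using \<nu>_unique k \<omega> by metis
qed

text \<open>In characteristic 2 the base reflection is the identity, which makes the two cases in the
  definition of \<open>A\<close> instances of the same formula.\<close>

lemma A_set_eq: "A_set X = (\<lambda>t. compose \<Omega> t \<nu>) ` reflections"
proof (cases "char2 G \<Omega>")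
  case True
  then have r: "reflections = J \<union> {\<lambda>\<omega>\<in>\<Omega>. \<omega>}" by (simp add: reflections_def)
  then have "\<nu> = (\<lambda>\<omega>\<in>\<Omega>. \<omega>)" using \<nu>_unique[of "\<lambda>\<omega>\<in>\<Omega>. \<omega>"] base by simp
  then have "compose \<Omega> t \<nu> = t" if "t \<in> reflections" for t
    using Bij[OF reflection_in[OF that]] by (auto simp: Bij_def compose_def extensional_def)
  then have "(\<lambda>t. compose \<Omega> t \<nu>) ` reflections = reflections" by simp
  then show ?thesis using True by (simp add: A_set_def one_eq r)
next
  case False
  then have r: "reflections = J" by (simp add: reflections_def)
  then have "nu X = \<nu>" by (simp add: nu_def \<nu>_def)
  moreover have "j \<otimes>\<^bsub>BijGroup \<Omega>\<^esub> \<nu> = compose \<Omega> j \<nu>" if "j \<in> J" for j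
    using that \<nu>_in by (simp add: mult_eq involution_iff)
  ultimately show ?thesis using False by (auto simp: A_set_def r)
qed

text \<open>Every point is of the form \<open>t o0\<close> with \<open>t\<close> a reflection, and every point other than \<open>o0\<close> is of
  the form \<open>g o1\<close> with \<open>g\<close> in the stabilizer of \<open>o0\<close>. Naming points in this way turns the two
  operations into applications of permutations.\<close>

lemma plus0_eq:
  assumes t: "t \<in> reflections" and \<beta>: "\<beta> \<in> \<Omega>"
  shows "plus0 X (t o0) \<beta> = t (\<nu> \<beta>)"
proof -
  have "(THE a. a \<in> A_set X \<and> a o0 = t o0) = compose \<Omega> t \<nu>"
  proof (rule the_equality)
    show "compose \<Omega> t \<nu> \<in> A_set X \<and> compose \<Omega> t \<nu> o0 = t o0"
      using t \<nu> base by (auto simp: A_set_eq compose_eq)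
    fix a assume a: "a \<in> A_set X \<and> a o0 = t o0"
    then obtain s where s: "s \<in> reflections" "a = compose \<Omega> s \<nu>" by (auto simp: A_set_eq)
    then have "s o0 = t o0" using a \<nu> base by (simp add: compose_eq)
    then show "a = compose \<Omega> t \<nu>" using reflection_eq s t base by metis
  qed
  then show ?thesis
    using closed[OF reflection_in[OF t] base(1)] \<beta> by (simp add: plus0_def compose_eq)
qed

lemma times1_eq:
  assumes g: "g \<in> G" "g o0 = o0" and \<beta>: "\<beta> \<in> \<Omega>"
  shows "times1 X (g o1) \<beta> = g \<beta>"
proof -
  have "(THE h. h \<in> G \<and> h o0 = o0 \<and> h o1 = g o1) = g"
    using g base by (intro the_equality eq_if_agree[of _ _ o0 o1]) auto
  moreover have "g o1 \<noteq> o0" using inj g base by metis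
  ultimately show ?thesis using closed[OF g(1) base(2)] \<beta> g by (simp add: times1_def)
qed

lemma times1_zero: "\<beta> \<in> \<Omega> \<Longrightarrow> times1 X o0 \<beta> = o0"
  using base by (simp add: times1_def)

lemma reflection_from_base:
  assumes "\<alpha> \<in> \<Omega>"
  obtains t where "t \<in> reflections" "t o0 = \<alpha>"
  using reflection_exists[OF base(1) assms] .

lemma dilation:
  assumes "\<alpha> \<in> \<Omega>" "\<alpha> \<noteq> o0"
  obtains g where "g \<in> G" "g o0 = o0" "g o1 = \<alpha>"
  using two_transitive[of o0 o1 o0 \<alpha>] base assms by metis

lemma compose3:
  assumes "g \<in> G" "h \<in> G" "k \<in> G"
  shows "\<exists>f \<in> G. \<forall>\<omega> \<in> \<Omega>. f \<omega> = g (h (k \<omega>))"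
  using assms by (intro bexI[of _ "compose \<Omega> g (compose \<Omega> h k)"])
    (simp_all add: compose_in compose_eq closed)

lemma plus0_closed: "\<lbrakk>\<alpha> \<in> \<Omega>; \<beta> \<in> \<Omega>\<rbrakk> \<Longrightarrow> plus0 X \<alpha> \<beta> \<in> \<Omega>"
  by (metis reflection_from_base plus0_eq closed[OF reflection_in] closed[OF \<nu>_in])

lemma times1_closed: "\<lbrakk>\<alpha> \<in> \<Omega>; \<beta> \<in> \<Omega>\<rbrakk> \<Longrightarrow> times1 X \<alpha> \<beta> \<in> \<Omega>"
  by (cases "\<alpha> = o0") (simp add: times1_zero base, metis dilation times1_eq closed)

abbreviation "KX \<equiv> omap K_functor X"

lemma K_simps [simp]:
  "carrier KX = \<Omega>" "mult KX = times1 X" "one KX = o1" "zero KX = o0" "add KX = plus0 X"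
  by (simp_all add: K_functor_def)

lemma loop_K: "loop (add_monoid KX)"
proof
  fix a b assume "a \<in> carrier (add_monoid KX)" "b \<in> carrier (add_monoid KX)"
  then have ab: "a \<in> \<Omega>" "b \<in> \<Omega>" by simp_all
  show "a \<otimes>\<^bsub>add_monoid KX\<^esub> b \<in> carrier (add_monoid KX)" using ab by (simp add: plus0_closed)
  obtain t where t: "t \<in> reflections" "t o0 = a" using reflection_from_base ab by metis
  note tG = reflection_in[OF t(1)]
  have "plus0 X a x = b \<longleftrightarrow> x = \<nu> (t b)" if "x \<in> \<Omega>" for x
    using plus0_eq[OF t(1) that] t(2) reflection_twice[OF t(1) ab(2)] \<nu>_twice[OF that]
      reflection_twice[OF t(1) closed[OF \<nu>_in that]] \<nu>_twice[OF closed[OF tG ab(2)]] by auto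
  moreover have "\<nu> (t b) \<in> \<Omega>" using closed[OF \<nu>_in closed[OF tG ab(2)]] .
  ultimately show "\<exists>!x. x \<in> carrier (add_monoid KX) \<and> a \<otimes>\<^bsub>add_monoid KX\<^esub> x = b" by auto
  have \<nu>a: "\<nu> a \<in> \<Omega>" using closed[OF \<nu>_in ab(1)] .
  obtain s where s: "s \<in> reflections" "s (\<nu> a) = b" using reflection_exists[OF \<nu>a ab(2)] .
  have "plus0 X y a = b \<longleftrightarrow> y = s o0" if y: "y \<in> \<Omega>" for y
  proof -
    obtain r where r: "r \<in> reflections" "r o0 = y" using reflection_from_base[OF y] .
    have "plus0 X y a = r (\<nu> a)" using plus0_eq[OF r(1) ab(1)] r(2) by simp
    moreover have "r (\<nu> a) = s (\<nu> a) \<longleftrightarrow> r o0 = s o0"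
      using reflection_eq[OF r(1) s(1)] \<nu>a base(1) by auto
    ultimately show ?thesis using r s by simp
  qed
  moreover have "s o0 \<in> \<Omega>" using closed reflection_in s base by blast
  ultimately show "\<exists>!y. y \<in> carrier (add_monoid KX) \<and> y \<otimes>\<^bsub>add_monoid KX\<^esub> a = b" by auto
next
  show "\<one>\<^bsub>add_monoid KX\<^esub> \<in> carrier (add_monoid KX)" using base by simp
next
  fix a assume "a \<in> carrier (add_monoid KX)"
  then have a: "a \<in> \<Omega>" by simp
  then show "\<one>\<^bsub>add_monoid KX\<^esub> \<otimes>\<^bsub>add_monoid KX\<^esub> a = a"
    using plus0_eq[OF \<nu>(1) a] \<nu> \<nu>_twice by simp
  obtain t where t: "t \<in> reflections" "t o0 = a" using reflection_from_base a by metis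
  then show "a \<otimes>\<^bsub>add_monoid KX\<^esub> \<one>\<^bsub>add_monoid KX\<^esub> = a"
    using plus0_eq[OF t(1) base(1)] \<nu> by simp
qed

lemma mult_group_K: "group (mult_of KX)"
proof (rule groupI)
  show "\<one>\<^bsub>mult_of KX\<^esub> \<in> carrier (mult_of KX)" using base by simp
next
  fix a assume "a \<in> carrier (mult_of KX)"
  then have a: "a \<in> \<Omega>" "a \<noteq> o0" by auto
  show "\<one>\<^bsub>mult_of KX\<^esub> \<otimes>\<^bsub>mult_of KX\<^esub> a = a"
    using times1_eq[OF id_in _ a(1)] a base by simp
  obtain g where g: "g \<in> G" "g o0 = o0" "g o1 = a" using dilation a by metis
  obtain g' where g': "g' \<in> G" "\<And>\<omega>. \<omega> \<in> \<Omega> \<Longrightarrow> g' (g \<omega>) = \<omega>" using inverse[OF g(1)] by metis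
  have "g' o0 = o0" using g'(2)[OF base(1)] g(2) by simp
  moreover have "g' a = o1" using g'(2)[OF base(2)] g(3) by simp
  moreover have "g' o1 \<noteq> o0" using inj[OF g'(1) base(2) base(1)] base(3) calculation(1) by auto
  ultimately have "times1 X (g' o1) a = o1" "g' o1 \<in> \<Omega> - {o0}"
    using times1_eq[OF g'(1)] closed[OF g'(1)] a base by auto
  then show "\<exists>b\<in>carrier (mult_of KX). b \<otimes>\<^bsub>mult_of KX\<^esub> a = \<one>\<^bsub>mult_of KX\<^esub>" by auto
next
  fix a b assume "a \<in> carrier (mult_of KX)" "b \<in> carrier (mult_of KX)"
  then have a: "a \<in> \<Omega>" "a \<noteq> o0" and b: "b \<in> \<Omega>" "b \<noteq> o0" by auto
  obtain g where g: "g \<in> G" "g o0 = o0" "g o1 = a" using dilation a by metis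
  have ab: "times1 X a b = g b" using times1_eq g b by metis
  have "g b \<noteq> o0" using inj[OF g(1) b(1) base(1)] g(2) b(2) by auto
  then show "a \<otimes>\<^bsub>mult_of KX\<^esub> b \<in> carrier (mult_of KX)"
    using ab closed g b by simp
  fix c assume "c \<in> carrier (mult_of KX)"
  then have c: "c \<in> \<Omega>" by auto
  obtain h where h: "h \<in> G" "h o0 = o0" "h o1 = b" using dilation b by metis
  have "times1 X (compose \<Omega> g h o1) c = compose \<Omega> g h c"
    using times1_eq[OF compose_in[OF g(1) h(1)] _ c] g(2) h(2) base(1) by (simp add: compose_eq)
  then have "times1 X (g b) c = g (h c)" using h base c by (simp add: compose_eq)
  also have "g (h c) = times1 X a (times1 X b c)"
    using times1_eq[OF g(1,2) closed[OF h(1) c]] times1_eq[OF h(1,2) c] g(3) h(3) by simp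
  finally show "a \<otimes>\<^bsub>mult_of KX\<^esub> b \<otimes>\<^bsub>mult_of KX\<^esub> c = a \<otimes>\<^bsub>mult_of KX\<^esub> (b \<otimes>\<^bsub>mult_of KX\<^esub> c)"
    using ab by simp
qed

text \<open>Left multiplication by \<open>a \<noteq> o0\<close> is an element of the stabilizer of \<open>o0\<close>. It commutes with \<open>\<nu>\<close>, and
  conjugation by it takes the reflection defining \<open>b + _\<close> to the one defining \<open>a b + _\<close>.\<close>

lemma distrib_K:
  assumes "a \<in> \<Omega>" "b \<in> \<Omega>" "c \<in> \<Omega>"
  shows "times1 X a (plus0 X b c) = plus0 X (times1 X a b) (times1 X a c)"
proof (cases "a = o0")
  case True
  have "plus0 X o0 o0 = o0" using loop.l_one[OF loop_K, of o0] base by simp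
  then show ?thesis using True assms by (simp add: times1_zero plus0_closed)
next
  case False
  obtain g where g: "g \<in> G" "g o0 = o0" "g o1 = a" using dilation False assms by metis
  obtain t where t: "t \<in> reflections" "t o0 = b" using reflection_from_base assms by metis
  obtain k where k: "k \<in> reflections" "\<And>\<omega>. \<omega> \<in> \<Omega> \<Longrightarrow> k (g \<omega>) = g (t \<omega>)"
    using reflection_conjugate_exists[OF t(1) g(1)] by metis
  have ga: "times1 X a x = g x" if "x \<in> \<Omega>" for x using times1_eq[OF g(1,2) that] g by simp
  have "k o0 = g b" using k(2)[OF base(1)] g t by simp
  then have "plus0 X (g b) (g c) = k (\<nu> (g c))"
    using plus0_eq[OF k(1) closed[OF g(1) assms(3)]] by simp
  also have "\<dots> = k (g (\<nu> c))" using \<nu>_commute[OF g(1,2) assms(3)] by simp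
  also have "\<dots> = g (t (\<nu> c))" using k(2)[OF closed[OF \<nu>_in assms(3)]] .
  also have "\<dots> = g (plus0 X b c)" using plus0_eq[OF t(1) assms(3)] t by simp
  finally show ?thesis
    using ga[OF plus0_closed[OF assms(2,3)]] ga[OF assms(2)] ga[OF assms(3)] by simp
qed

text \<open>Let \<open>t\<close>, \<open>s\<close> and \<open>u\<close> be the reflections taking the base point to \<open>a\<close>, \<open>b\<close> and \<open>a + b\<close>. Then
  \<open>u \<nu>\<close> takes the base point where \<open>t \<nu> s \<nu>\<close> takes it, so the two differ by an element of the
  stabilizer, that is, by a left multiplication.\<close>

lemma weak_assoc_K:
  assumes "a \<in> \<Omega>" "b \<in> \<Omega>"
  shows "\<exists>d \<in> \<Omega> - {o0}. \<forall>x \<in> \<Omega>. plus0 X a (plus0 X b x) = plus0 X (plus0 X a b) (times1 X d x)"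
proof -
  obtain t where t: "t \<in> reflections" "t o0 = a" using reflection_from_base assms by metis
  obtain s where s: "s \<in> reflections" "s o0 = b" using reflection_from_base assms by metis
  obtain u where u: "u \<in> reflections" "u o0 = plus0 X a b"
    using reflection_from_base plus0_closed assms by metis
  note refl = t(1) s(1) u(1) \<nu>(1)
  note G = refl[THEN reflection_in]
  have c: "plus0 X a b = t (\<nu> b)" using plus0_eq t assms by metis
  obtain h1 where h1: "h1 \<in> G" "\<And>\<omega>. \<omega> \<in> \<Omega> \<Longrightarrow> h1 \<omega> = \<nu> (s (\<nu> \<omega>))"
    using compose3[OF \<nu>_in G(2) \<nu>_in] by blast
  obtain h2 where h2: "h2 \<in> G" "\<And>\<omega>. \<omega> \<in> \<Omega> \<Longrightarrow> h2 \<omega> = u (t (h1 \<omega>))"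
    using compose3[OF G(3) G(1) h1(1)] by blast
  define h where "h = compose \<Omega> \<nu> h2"
  have h: "h \<in> G" "\<And>\<omega>. \<omega> \<in> \<Omega> \<Longrightarrow> h \<omega> = \<nu> (u (t (h1 \<omega>)))"
    using compose_in[OF \<nu>_in h2(1)] by (simp_all add: h_def compose_eq h2(2))
  have "u (plus0 X a b) = o0" using reflection_twice[OF u(1) base(1)] u by simp
  then have "u (t (\<nu> b)) = o0" by (simp only: c)
  then have h0: "h o0 = o0" using h(2)[OF base(1)] h1(2)[OF base(1)] \<nu>(2) s(2) by simp
  have "h o1 \<noteq> o0" using inj[OF h(1) base(2) base(1)] h0 base(3) by auto
  then have d: "h o1 \<in> \<Omega> - {o0}" using closed[OF h(1) base(2)] by simp
  moreover have "plus0 X a (plus0 X b x) = plus0 X (plus0 X a b) (times1 X (h o1) x)"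
    if x: "x \<in> \<Omega>" for x
  proof -
    have "plus0 X (plus0 X a b) (times1 X (h o1) x) = u (\<nu> (h x))"
      using plus0_eq[OF u(1) closed[OF h(1) x]] u times1_eq[OF h(1) h0 x] by simp
    also have "\<dots> = t (\<nu> (s (\<nu> x)))"
    proof -
      have "t (\<nu> (s (\<nu> x))) \<in> \<Omega>" using closed G x by blast
      then show ?thesis
        using h(2)[OF x] h1(2)[OF x] closed[OF G(3)] by (simp add: \<nu>_twice reflection_twice[OF u(1)])
    qed
    also have "\<dots> = plus0 X a (plus0 X b x)"
      using plus0_eq[OF s(1) x] plus0_eq[OF t(1) plus0_closed[OF assms(2) x]] s t by simp
    finally show ?thesis by simp
  qed
  ultimately show ?thesis by blast
qed

lemma neardomain_K: "neardomain KX"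
proof (rule neardomain.intro)
  show "add KX \<in> carrier KX \<rightarrow>\<^sub>E carrier KX \<rightarrow>\<^sub>E carrier KX"
    using plus0_closed by (auto simp: PiE_def Pi_def extensional_def) (simp_all add: plus0_def)
  show "mult KX \<in> carrier KX \<rightarrow>\<^sub>E carrier KX \<rightarrow>\<^sub>E carrier KX"
    using times1_closed by (auto simp: PiE_def Pi_def extensional_def) (simp_all add: times1_def)
  show "loop (add_monoid KX)" by (rule loop_K)
  show "group (mult_of KX)" by (rule mult_group_K)
next
  fix a b assume "a \<in> carrier KX" "b \<in> carrier KX" "a \<oplus>\<^bsub>KX\<^esub> b = \<zero>\<^bsub>KX\<^esub>"
  then have ab: "a \<in> \<Omega>" "b \<in> \<Omega>" "plus0 X a b = o0" by simp_all
  obtain t where t: "t \<in> reflections" "t o0 = a" using reflection_from_base ab by metis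
  obtain s where s: "s \<in> reflections" "s o0 = b" using reflection_from_base ab by metis
  have "t (\<nu> b) = o0" using plus0_eq t ab by metis
  then have "\<nu> b = a" using reflection_twice t ab closed \<nu>_in by metis
  then have "\<nu> a = b" using \<nu>_twice ab by blast
  then have "s (\<nu> a) = o0" using reflection_twice s base by metis
  then show "b \<oplus>\<^bsub>KX\<^esub> a = \<zero>\<^bsub>KX\<^esub>" using plus0_eq[OF s(1) ab(1)] s by simp
qed (simp_all add: times1_zero distrib_K weak_assoc_K)

text \<open>If \<open>A\<close> is closed under composition, \<open>t \<nu> s \<nu>\<close> is itself of the form \<open>u \<nu>\<close>, so addition is
  associative.\<close>

lemma nearfield_K:
  assumes A: "subgroup (A_set X) (grp_of G \<Omega>)"
  shows "nearfield KX"
proof -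
  interpret K: neardomain KX by (rule neardomain_K)
  have "plus0 X a (plus0 X b x) = plus0 X (plus0 X a b) x"
    if abx: "a \<in> \<Omega>" "b \<in> \<Omega>" "x \<in> \<Omega>" for a b x
  proof -
    obtain t where t: "t \<in> reflections" "t o0 = a" using reflection_from_base abx by metis
    obtain s where s: "s \<in> reflections" "s o0 = b" using reflection_from_base abx by metis
    let ?t = "compose \<Omega> t \<nu>" and ?s = "compose \<Omega> s \<nu>"
    have "?t \<in> A_set X" "?s \<in> A_set X" using s t by (auto simp: A_set_eq)
    from subgroup.m_closed[OF A this] have "compose \<Omega> ?t ?s \<in> A_set X"
      using s t \<nu>_in by (simp add: grp_of_def mult_eq compose_in reflection_in)
    then obtain u where u: "u \<in> reflections" "compose \<Omega> ?t ?s = compose \<Omega> u \<nu>"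
      by (auto simp: A_set_eq)
    have eq: "t (\<nu> (s (\<nu> y))) = u (\<nu> y)" if "y \<in> \<Omega>" for y
      using fun_cong[OF u(2), of y] that closed reflection_in s(1) \<nu>_in by (simp add: compose_eq)
    have "u o0 = plus0 X a b" using eq[OF base(1)] \<nu> s t plus0_eq[OF t(1) abx(2)] by simp
    then have "plus0 X (plus0 X a b) x = u (\<nu> x)" using plus0_eq[OF u(1) abx(3)] by simp
    also have "\<dots> = plus0 X a (plus0 X b x)"
      using eq[OF abx(3)] plus0_eq[OF s(1) abx(3)]
        plus0_eq[OF t(1) plus0_closed[OF abx(2,3)]] s t by simp
    finally show ?thesis by simp
  qed
  note assoc = this
  show ?thesis
  proof
    fix a b d
    assume ab: "a \<in> carrier KX" "b \<in> carrier KX" and d: "d \<in> carrier KX - {\<zero>\<^bsub>KX\<^esub>}"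
      and *: "\<forall>x\<in>carrier KX. a \<oplus>\<^bsub>KX\<^esub> (b \<oplus>\<^bsub>KX\<^esub> x) = a \<oplus>\<^bsub>KX\<^esub> b \<oplus>\<^bsub>KX\<^esub> d \<otimes>\<^bsub>KX\<^esub> x"
    have "(a \<oplus>\<^bsub>KX\<^esub> b) \<oplus>\<^bsub>KX\<^esub> \<one>\<^bsub>KX\<^esub> = (a \<oplus>\<^bsub>KX\<^esub> b) \<oplus>\<^bsub>KX\<^esub> d"
      using *[rule_format, OF K.one_closed] assoc[of a b o1] ab d K.mult_one[of d] base by simp
    then show "d = \<one>\<^bsub>KX\<^esub>"
      using K.add_cancel[OF K.add_closed[OF ab] K.one_closed, of d] d by auto
  qed
qed

text \<open>Let \<open>t\<close> be the reflection taking \<open>o0\<close> to \<open>g o0\<close>. Then \<open>\<nu> t g\<close> fixes \<open>o0\<close>, so it is a left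
  multiplication, and \<open>g = (t \<nu>) (\<nu> t g)\<close> is a left multiplication followed by a left
  addition.\<close>

lemma affine_form:
  assumes g: "g \<in> G"
  shows "\<exists>m \<in> \<Omega> - {o0}. \<forall>x \<in> \<Omega>. g x = plus0 X (g o0) (times1 X m x)"
proof -
  obtain t where t: "t \<in> reflections" "t o0 = g o0"
    using reflection_from_base closed[OF g base(1)] by metis
  note tG = reflection_in[OF t(1)]
  obtain h where h: "h \<in> G" "\<And>x. x \<in> \<Omega> \<Longrightarrow> h x = \<nu> (t (g x))"
    using compose3[OF \<nu>_in tG g] by blast
  have h0: "h o0 = o0" using h base t reflection_twice \<nu> by metis
  have "g x = plus0 X (g o0) (times1 X (h o1) x)" if x: "x \<in> \<Omega>" for x
    using plus0_eq[OF t(1) closed[OF h(1) x]] times1_eq[OF h(1) h0 x] h(2)[OF x] t x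
      closed g tG by (simp add: \<nu>_twice reflection_twice)
  moreover have "h o1 \<noteq> o0" using inj[OF h(1) base(2) base(1)] h0 base(3) by auto
  ultimately show ?thesis using closed[OF h(1) base(2)] by blast
qed

lemma affine_map_exists:
  assumes "a \<in> \<Omega>" "m \<in> \<Omega>" "m \<noteq> o0"
  shows "\<exists>g \<in> G. \<forall>x \<in> \<Omega>. g x = plus0 X a (times1 X m x)"
proof -
  obtain t where t: "t \<in> reflections" "t o0 = a" using reflection_from_base assms by metis
  obtain h where h: "h \<in> G" "h o0 = o0" "h o1 = m" using dilation assms by metis
  obtain g where g: "g \<in> G" "\<And>x. x \<in> \<Omega> \<Longrightarrow> g x = t (\<nu> (h x))"
    using compose3[OF reflection_in[OF t(1)] \<nu>_in h(1)] by blast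
  have "g x = plus0 X a (times1 X m x)" if x: "x \<in> \<Omega>" for x
    using plus0_eq[OF t(1) closed[OF h(1) x]] times1_eq[OF h(1,2) x] g(2)[OF x] t h by simp
  then show ?thesis using g(1) by blast
qed

lemma Grp_eq_affine:
  "G = {\<lambda>x\<in>\<Omega>. plus0 X a (times1 X m x) | a m. a \<in> \<Omega> \<and> m \<in> \<Omega> - {o0}}" (is "_ = ?A")
proof (intro equalityI subsetI)
  fix g assume g: "g \<in> G"
  obtain m where m: "m \<in> \<Omega>" "m \<noteq> o0" "\<And>x. x \<in> \<Omega> \<Longrightarrow> g x = plus0 X (g o0) (times1 X m x)"
    using affine_form[OF g] by blast
  have "g = (\<lambda>x\<in>\<Omega>. plus0 X (g o0) (times1 X m x))"
    using Bij[OF g] m(3) by (intro extensionalityI[of _ \<Omega>]) (auto simp: Bij_def)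
  then show "g \<in> ?A" using m closed[OF g base(1)] by blast
next
  fix f assume "f \<in> ?A"
  then obtain a m where f: "f = (\<lambda>x\<in>\<Omega>. plus0 X a (times1 X m x))" and am: "a \<in> \<Omega>" "m \<in> \<Omega>" "m \<noteq> o0"
    by blast
  obtain g where g: "g \<in> G" "\<And>x. x \<in> \<Omega> \<Longrightarrow> g x = plus0 X a (times1 X m x)"
    using affine_map_exists[OF am] by blast
  have "f = g" using Bij[OF g(1)] g(2) unfolding f
    by (intro extensionalityI[of _ \<Omega>]) (auto simp: Bij_def)
  then show "f \<in> G" using g by simp
qed

text \<open>The reflection taking \<open>o0\<close> to \<open>o1\<close> swaps the two, so \<open>o1 + o1 = o0\<close> says that \<open>\<nu>\<close> fixes \<open>o1\<close>
  as well as \<open>o0\<close>, that is, that the identity is a reflection.\<close>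

lemma char2_iff: "char2 G \<Omega> \<longleftrightarrow> plus0 X o1 o1 = o0"
proof -
  obtain t where t: "t \<in> reflections" "t o0 = o1" using reflection_from_base base by metis
  have *: "plus0 X o1 o1 = t (\<nu> o1)" using plus0_eq[OF t(1) base(2)] t by simp
  have t1: "t o1 = o0" using reflection_twice t base by metis
  show ?thesis
  proof
    assume "char2 G \<Omega>"
    then have "\<nu> = (\<lambda>\<omega>\<in>\<Omega>. \<omega>)"
      using \<nu>_unique[of "\<lambda>\<omega>\<in>\<Omega>. \<omega>"] base by (simp add: reflections_def)
    then show "plus0 X o1 o1 = o0" using * t1 base by simp
  next
    assume "plus0 X o1 o1 = o0"
    then have "\<nu> o1 = o1"
      using * t1 inj[OF reflection_in[OF t(1)]] closed[OF \<nu>_in] base by metis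
    then have "\<nu> = (\<lambda>\<omega>\<in>\<Omega>. \<omega>)"
      using \<nu> base by (intro eq_if_agree[of _ _ o0 o1]) (auto simp: \<nu>_in id_in)
    moreover have "(\<lambda>\<omega>\<in>\<Omega>. \<omega>) \<notin> J" by (simp add: involution_iff)
    ultimately show "char2 G \<Omega>" using \<nu>(1) by (auto simp: reflections_def split: if_splits)
  qed
qed

end


section \<open>The functor on morphisms\<close>

lemma s2t_HomD:
  assumes "s2t_Hom X Y (f, \<Phi>)"
  shows "char2 (Grp X) (Pts X) \<longleftrightarrow> char2 (Grp Y) (Pts Y)"
    and "f \<in> hom (grp_of (Grp X) (Pts X)) (grp_of (Grp Y) (Pts Y))" and "f \<in> extensional (Grp X)"
    and "\<Phi> \<in> Pts X \<rightarrow>\<^sub>E Pts Y" and "inj_on \<Phi> (Pts X)"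
    and "\<Phi> (base0 X) = base0 Y" and "\<Phi> (base1 X) = base1 Y"
    and "\<And>g \<omega>. \<lbrakk>g \<in> Grp X; \<omega> \<in> Pts X\<rbrakk> \<Longrightarrow> \<Phi> (g \<omega>) = f g (\<Phi> \<omega>)"
    and "\<And>g. g \<in> Grp X \<Longrightarrow> f g \<in> Grp Y"
    and "\<And>\<omega>. \<omega> \<in> Pts X \<Longrightarrow> \<Phi> \<omega> \<in> Pts Y"
  using assms by (auto simp: s2t_Hom_def hom_def grp_of_def)

lemma carrier_grp_of [simp]: "carrier (grp_of G \<Omega>) = G"
  by (simp add: grp_of_def)

lemma mult_grp_of [simp]: "mult (grp_of G \<Omega>) = mult (BijGroup \<Omega>)"
  by (simp add: grp_of_def)

lemma s2t_Hom_Ident: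
  assumes "s2t_object X"
  shows "s2t_Hom X X ((\<lambda>g \<in> Grp X. g), (\<lambda>\<omega> \<in> Pts X. \<omega>))"
proof -
  interpret pointed_s2t X by unfold_locales fact
  show ?thesis
    by (auto simp: s2t_Hom_def hom_def base closed mult_eq compose_in inj_on_def)
qed

lemma s2t_Hom_Comp:
  assumes X: "s2t_object X" and f: "s2t_Hom X Y (f, \<Phi>)" and g: "s2t_Hom Y Z (g, \<Psi>)"
  shows "s2t_Hom X Z (compose (Grp X) g f, compose (Pts X) \<Psi> \<Phi>)"
proof -
  interpret pointed_s2t X by unfold_locales fact
  note F = s2t_HomD[OF f] and G = s2t_HomD[OF g]
  have "compose (Grp X) g f \<in> hom (grp_of (Grp X) (Pts X)) (grp_of (Grp Z) (Pts Z))"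
  proof (rule homI)
    fix a assume "a \<in> carrier (grp_of (Grp X) (Pts X))"
    then show "compose (Grp X) g f a \<in> carrier (grp_of (Grp Z) (Pts Z))"
      by (simp add: compose_eq F(9) G(9))
  next
    fix a b assume "a \<in> carrier (grp_of (Grp X) (Pts X))" "b \<in> carrier (grp_of (Grp X) (Pts X))"
    then have ab: "a \<in> Grp X" "b \<in> Grp X" by simp_all
    then have "a \<otimes>\<^bsub>BijGroup (Pts X)\<^esub> b \<in> Grp X" by (simp add: mult_eq compose_in)
    then show "compose (Grp X) g f (a \<otimes>\<^bsub>grp_of (Grp X) (Pts X)\<^esub> b)
        = compose (Grp X) g f a \<otimes>\<^bsub>grp_of (Grp Z) (Pts Z)\<^esub> compose (Grp X) g f b"
      using ab hom_mult[OF F(2), of a b] hom_mult[OF G(2), of "f a" "f b"] F(9)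
      by (simp add: compose_eq)
  qed
  moreover have "inj_on (compose (Pts X) \<Psi> \<Phi>) (Pts X)"
    using F(5,10) G(5) by (auto simp: inj_on_def compose_eq)
  moreover have "compose (Pts X) \<Psi> \<Phi> (a x) = compose (Grp X) g f a (compose (Pts X) \<Psi> \<Phi> x)"
    if "a \<in> Grp X" "x \<in> Pts X" for a x
    using that F(8)[OF that] G(8)[OF F(9)[OF that(1)] F(10)[OF that(2)]]
    by (simp add: compose_eq closed)
  ultimately show ?thesis
    using F(1,6,7,10) G(1,6,7,10)
    by (simp add: s2t_Hom_def compose_eq base PiE_def compose_extensional)
qed

lemma category_s2t_Gp: "category (s2t_Gp :: ('a s2t, _) cat)"
proof
  fix X :: "'a s2t" assume "X \<in> Obj s2t_Gp"
  then show "Ident s2t_Gp X \<in> Hom s2t_Gp X X" by (simp add: s2t_Hom_Ident)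
next
  fix X Y Z :: "'a s2t" and p q
  assume "X \<in> Obj s2t_Gp" "p \<in> Hom s2t_Gp X Y" "q \<in> Hom s2t_Gp Y Z"
  then show "Comp s2t_Gp X Y Z q p \<in> Hom s2t_Gp X Z"
    by (cases p; cases q) (auto intro: s2t_Hom_Comp)
next
  fix X Y :: "'a s2t" and p assume p: "p \<in> Hom s2t_Gp X Y"
  obtain f \<Phi> where fp: "p = (f, \<Phi>)" by (cases p)
  note F = s2t_HomD[OF p[simplified fp s2t_Gp_simps mem_Collect_eq]]
  have ext: "f \<in> extensional (Grp X)" "\<Phi> \<in> extensional (Pts X)" using F(3,4) by (auto simp: PiE_def)
  show "Comp s2t_Gp X X Y p (Ident s2t_Gp X) = p"
    using ext by (auto simp: fp compose_def extensional_def)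
  show "Comp s2t_Gp X Y Y (Ident s2t_Gp Y) p = p"
    using ext F(9,10) by (auto simp: fp compose_def extensional_def)
next
  fix W X Y Z :: "'a s2t" and p q r
  assume p: "p \<in> Hom s2t_Gp W X"
  obtain f \<Phi> where fp: "p = (f, \<Phi>)" by (cases p)
  note F = s2t_HomD[OF p[simplified fp s2t_Gp_simps mem_Collect_eq]]
  show "Comp s2t_Gp W Y Z r (Comp s2t_Gp W X Y q p) = Comp s2t_Gp W X Z (Comp s2t_Gp X Y Z r q) p"
    using F(9,10) by (cases q; cases r) (auto simp: fp compose_def)
qed

lemma amap_K [simp]: "amap K_functor X Y (f, \<Phi>) = \<Phi>"
  by (simp add: K_functor_def)

locale two_pointed_s2t = X: pointed_s2t X + Y: pointed_s2t Y
  for X Y :: "'a s2t"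
begin

text \<open>Since \<open>\<Phi>\<close> is injective and equivariant, \<open>f\<close> does not annihilate an involution. The identity is
  a reflection on either side or on neither, because the characteristics agree.\<close>

lemma reflection_image:
  assumes f: "s2t_Hom X Y (f, \<Phi>)" and t: "t \<in> X.reflections"
  shows "f t \<in> Y.reflections"
proof -
  note F = s2t_HomD[OF f]
  have involution: "f j \<in> Y.J" if j: "j \<in> X.J" for j
  proof -
    have jG: "j \<in> X.G" using j by (simp add: X.involution_iff)
    have fj: "f j \<in> Y.G" using F(9)[OF jG] .
    obtain \<alpha> where \<alpha>: "\<alpha> \<in> X.\<Omega>" "j \<alpha> \<noteq> \<alpha>" using j by (auto simp: X.involution_iff)
    have j\<alpha>: "j \<alpha> \<in> X.\<Omega>" "j (j \<alpha>) = \<alpha>" using X.closed[OF jG] \<alpha> j by (auto simp: X.involution_iff)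
    have 1: "f j (\<Phi> \<alpha>) = \<Phi> (j \<alpha>)" using F(8)[OF jG \<alpha>(1)] by simp
    have 2: "f j (\<Phi> (j \<alpha>)) = \<Phi> \<alpha>" using F(8)[OF jG j\<alpha>(1)] j\<alpha> by simp
    have 3: "\<Phi> (j \<alpha>) \<noteq> \<Phi> \<alpha>" using F(5) \<alpha> j\<alpha> by (auto simp: inj_on_def)
    obtain k where k: "k \<in> Y.J" "k (\<Phi> \<alpha>) = \<Phi> (j \<alpha>)" "k (\<Phi> (j \<alpha>)) = \<Phi> \<alpha>"
      using Y.involution_swapping[OF F(10)[OF \<alpha>(1)] F(10)[OF j\<alpha>(1)]] 3 by metis
    have "f j = k"
      using 1 2 3 k fj F(10) \<alpha> j\<alpha>
      by (intro Y.eq_if_agree[of _ _ "\<Phi> \<alpha>" "\<Phi> (j \<alpha>)"]) (auto simp: Y.involution_iff)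
    then show ?thesis using k by simp
  qed
  show ?thesis
  proof (cases "t \<in> X.J")
    case True
    then show ?thesis using involution by (simp add: Y.reflections_def)
  next
    case False
    then have t: "t = (\<lambda>\<omega>\<in>X.\<Omega>. \<omega>)" and c: "char2 X.G X.\<Omega>"
      using t by (auto simp: X.reflections_def split: if_splits)
    have tG: "t \<in> X.G" using X.id_in t by simp
    have fx: "f t (\<Phi> x) = \<Phi> x" if "x \<in> X.\<Omega>" for x using F(8)[OF tG that] t that by simp
    have "f t = (\<lambda>\<omega>\<in>Y.\<Omega>. \<omega>)"
      using fx[OF X.base(1)] fx[OF X.base(2)] F(6,7) F(9)[OF tG] Y.base
      by (intro Y.eq_if_agree[of _ _ Y.o0 Y.o1]) (auto simp: Y.id_in)
    then show ?thesis using c F(1) by (simp add: Y.reflections_def)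
  qed
qed

text \<open>The image of \<open>\<nu>\<close> is a reflection fixing the base point, hence the base reflection of \<open>Y\<close>. So \<open>f\<close>
  carries the permutations defining the operations on \<open>X\<close> to those defining the operations on
  \<open>Y\<close>.\<close>

lemma K_hom:
  assumes f: "s2t_Hom X Y (f, \<Phi>)"
  shows "\<Phi> \<in> ring_hom X.KX Y.KX"
proof (rule ring_hom_memI)
  note F = s2t_HomD[OF f]
  show "\<Phi> \<one>\<^bsub>X.KX\<^esub> = \<one>\<^bsub>Y.KX\<^esub>" using F(7) by simp
  fix x y assume "x \<in> carrier X.KX" "y \<in> carrier X.KX"
  then have x: "x \<in> X.\<Omega>" and y: "y \<in> X.\<Omega>" by simp_all
  show "\<Phi> x \<in> carrier Y.KX" using F(10)[OF x] by simp
  obtain t where t: "t \<in> X.reflections" "t X.o0 = x" using X.reflection_from_base[OF x] .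
  have "f X.\<nu> Y.o0 = Y.o0" using F(8)[OF X.\<nu>_in X.base(1)] X.\<nu>(2) F(6) by simp
  then have \<nu>: "f X.\<nu> = Y.\<nu>" using Y.\<nu>_unique[OF reflection_image[OF f X.\<nu>(1)]] by simp
  note tG = X.reflection_in[OF t(1)]
  have "\<Phi> (t (X.\<nu> y)) = f t (Y.\<nu> (\<Phi> y))"
    using F(8)[OF tG X.closed[OF X.\<nu>_in y]] F(8)[OF X.\<nu>_in y] \<nu> by simp
  moreover have "f t Y.o0 = \<Phi> x" using F(8)[OF tG X.base(1)] F(6) t by simp
  ultimately show "\<Phi> (x \<oplus>\<^bsub>X.KX\<^esub> y) = \<Phi> x \<oplus>\<^bsub>Y.KX\<^esub> \<Phi> y"
    using X.plus0_eq[OF t(1) y] t(2) Y.plus0_eq[OF reflection_image[OF f t(1)] F(10)[OF y]] by simp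
  show "\<Phi> (x \<otimes>\<^bsub>X.KX\<^esub> y) = \<Phi> x \<otimes>\<^bsub>Y.KX\<^esub> \<Phi> y"
  proof (cases "x = X.o0")
    case True
    then show ?thesis using F(6) F(10)[OF y] y by (simp add: X.times1_zero Y.times1_zero)
  next
    case False
    obtain g where g: "g \<in> X.G" "g X.o0 = X.o0" "g X.o1 = x" using X.dilation[OF x False] .
    have 0: "f g Y.o0 = Y.o0" using F(8)[OF g(1) X.base(1)] F(6) g by simp
    have 1: "f g Y.o1 = \<Phi> x" using F(8)[OF g(1) X.base(2)] F(7) g by simp
    show ?thesis
      using Y.times1_eq[OF F(9)[OF g(1)] 0 F(10)[OF y]] X.times1_eq[OF g(1,2) y] F(8)[OF g(1) y] 1 g
      by simp
  qed
qed

text \<open>Equivariance prescribes the values of \<open>f a\<close> at the two base points of \<open>Y\<close>.\<close>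

lemma K_faithful:
  assumes f: "s2t_Hom X Y (f, \<Phi>)" and g: "s2t_Hom X Y (g, \<Phi>)"
  shows "f = g"
proof (rule extensionalityI)
  note F = s2t_HomD[OF f] and G = s2t_HomD[OF g]
  show "f \<in> extensional X.G" "g \<in> extensional X.G" using F G by auto
  fix a assume a: "a \<in> X.G"
  show "f a = g a"
  proof (rule Y.eq_if_agree[OF F(9)[OF a] G(9)[OF a] Y.base])
    show "f a Y.o0 = g a Y.o0" using F(8)[OF a X.base(1)] G(8)[OF a X.base(1)] F(6) by simp
    show "f a Y.o1 = g a Y.o1" using F(8)[OF a X.base(2)] G(8)[OF a X.base(2)] F(7) by simp
  qed
qed

text \<open>The element \<open>x \<mapsto> a + m x\<close> has to be sent to \<open>x \<mapsto> \<Phi> a + \<Phi> m x\<close>. The map \<open>f\<close> is chosen through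
  its equivariance instead; being multiplicative then follows from the fact that the two base points
  separate the elements of the group.\<close>

lemma K_full:
  assumes \<Phi>: "\<Phi> \<in> ring_hom X.KX Y.KX" and ext: "\<Phi> \<in> extensional X.\<Omega>"
  obtains f where "s2t_Hom X Y (f, \<Phi>)"
proof -
  interpret KX: neardomain X.KX by (rule X.neardomain_K)
  note hom = ring_hom_closed[OF \<Phi>, simplified] ring_hom_add[OF \<Phi>, simplified]
    ring_hom_mult[OF \<Phi>, simplified] ring_hom_one[OF \<Phi>, simplified]
    KX.hom_zero[OF Y.neardomain_K \<Phi>, simplified]
  have ex: "\<exists>h \<in> Y.G. \<forall>x \<in> X.\<Omega>. h (\<Phi> x) = \<Phi> (g x)" if g: "g \<in> X.G" for g
  proof -
    obtain m where m: "m \<in> X.\<Omega>" "m \<noteq> X.o0"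
      "\<And>x. x \<in> X.\<Omega> \<Longrightarrow> g x = plus0 X (g X.o0) (times1 X m x)"
      using X.affine_form[OF g] by blast
    have g0: "g X.o0 \<in> X.\<Omega>" using X.closed[OF g X.base(1)] .
    have "\<Phi> m \<noteq> Y.o0" using KX.hom_nonzero[OF Y.neardomain_K \<Phi>, simplified, OF m(1,2)] .
    then obtain h where h: "h \<in> Y.G"
      "\<And>x. x \<in> Y.\<Omega> \<Longrightarrow> h x = plus0 Y (\<Phi> (g X.o0)) (times1 Y (\<Phi> m) x)"
      using Y.affine_map_exists[OF hom(1)[OF g0] hom(1)[OF m(1)]] by blast
    have "h (\<Phi> x) = \<Phi> (g x)" if x: "x \<in> X.\<Omega>" for x
      using h(2)[OF hom(1)[OF x]] m(3)[OF x] hom(2)[OF g0 X.times1_closed[OF m(1) x]]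
        hom(3)[OF m(1) x] by simp
    then show ?thesis using h(1) by blast
  qed
  have inj: "inj_on \<Phi> X.\<Omega>" using KX.hom_inj_on[OF Y.neardomain_K \<Phi>] by simp
  define f where "f = (\<lambda>g \<in> X.G. SOME h. h \<in> Y.G \<and> (\<forall>x \<in> X.\<Omega>. h (\<Phi> x) = \<Phi> (g x)))"
  have f: "f g \<in> Y.G" "\<forall>x \<in> X.\<Omega>. f g (\<Phi> x) = \<Phi> (g x)" if "g \<in> X.G" for g
    using someI_ex[OF ex[OF that, unfolded Bex_def]] that by (simp_all add: f_def)
  have "f \<in> hom (grp_of X.G X.\<Omega>) (grp_of Y.G Y.\<Omega>)"
  proof (rule homI)
    fix a assume "a \<in> carrier (grp_of X.G X.\<Omega>)"
    then show "f a \<in> carrier (grp_of Y.G Y.\<Omega>)" using f by simp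
  next
    fix a b assume "a \<in> carrier (grp_of X.G X.\<Omega>)" "b \<in> carrier (grp_of X.G X.\<Omega>)"
    then have a: "a \<in> X.G" and b: "b \<in> X.G" by simp_all
    let ?c = "compose X.\<Omega> a b" and ?d = "compose Y.\<Omega> (f a) (f b)"
    have c: "?c \<in> X.G" using X.compose_in[OF a b] .
    have d: "?d \<in> Y.G" using Y.compose_in f a b by simp
    have *: "f ?c (\<Phi> x) = ?d (\<Phi> x)" if x: "x \<in> X.\<Omega>" for x
      using f(2)[OF c] f(2)[OF a] f(2)[OF b] x hom(1)[OF x] X.closed[OF b x] by (simp add: compose_eq)
    have "f ?c = ?d"
      using *[OF X.base(1)] *[OF X.base(2)] hom(4,5)
      by (intro Y.eq_if_agree[OF f(1)[OF c] d Y.base]) simp_all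
    then show "f (a \<otimes>\<^bsub>grp_of X.G X.\<Omega>\<^esub> b) = f a \<otimes>\<^bsub>grp_of Y.G Y.\<Omega>\<^esub> f b"
      using a b f by (simp add: X.mult_eq Y.mult_eq)
  qed
  moreover have "char2 X.G X.\<Omega> \<longleftrightarrow> char2 Y.G Y.\<Omega>"
  proof -
    have "\<Phi> (plus0 X X.o1 X.o1) = plus0 Y Y.o1 Y.o1"
      using hom(2)[OF X.base(2) X.base(2)] hom(4) by simp
    moreover have "plus0 X X.o1 X.o1 \<in> X.\<Omega>" using X.plus0_closed X.base by simp
    ultimately have "plus0 X X.o1 X.o1 = X.o0 \<longleftrightarrow> plus0 Y Y.o1 Y.o1 = Y.o0"
      using inj hom(5) X.base(1) unfolding inj_on_def by metis
    then show ?thesis by (simp add: X.char2_iff Y.char2_iff)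
  qed
  moreover have "f \<in> extensional X.G" by (simp add: f_def)
  ultimately have "s2t_Hom X Y (f, \<Phi>)"
    using inj ext hom(1,4,5) f(2) by (auto simp: s2t_Hom_def PiE_def)
  then show ?thesis by (rule that)
qed

lemma bij_betw_amap_K:
  "bij_betw (amap K_functor X Y) (Hom s2t_Gp X Y) (Hom n_Dom X.KX Y.KX)"
proof (rule bij_betw_imageI)
  show "inj_on (amap K_functor X Y) (Hom s2t_Gp X Y)"
    using K_faithful by (auto simp: inj_on_def)
  show "amap K_functor X Y ` Hom s2t_Gp X Y = Hom n_Dom X.KX Y.KX"
  proof (intro equalityI subsetI)
    fix \<Phi> assume "\<Phi> \<in> amap K_functor X Y ` Hom s2t_Gp X Y"
    then obtain f where f: "s2t_Hom X Y (f, \<Phi>)" by auto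
    then show "\<Phi> \<in> Hom n_Dom X.KX Y.KX" using K_hom[OF f] s2t_HomD(4)[OF f] by (auto simp: PiE_def)
  next
    fix \<Phi> assume "\<Phi> \<in> Hom n_Dom X.KX Y.KX"
    then obtain f where "s2t_Hom X Y (f, \<Phi>)" using K_full by auto
    then show "\<Phi> \<in> amap K_functor X Y ` Hom s2t_Gp X Y"
      by (intro image_eqI[of _ _ "(f, \<Phi>)"]) simp_all
  qed
qed

lemma K_object_determined:
  assumes eq: "X.KX = Y.KX"
  shows "X = Y"
proof -
  have e: "Pts X = Pts Y" "base0 X = base0 Y" "base1 X = base1 Y" "plus0 X = plus0 Y" "times1 X = times1 Y"
    using eq by (simp_all add: K_functor_def)
  then have "Grp X = Grp Y" using X.Grp_eq_affine Y.Grp_eq_affine by simp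
  then show ?thesis using e by simp
qed

end

lemma is_functor_K: "is_functor (s2t_Gp :: ('a s2t, _) cat) n_Dom K_functor"
proof -
  interpret S: category "s2t_Gp :: ('a s2t, _) cat" by (rule category_s2t_Gp)
  interpret N: category "n_Dom :: ('a ring, _) cat" by (rule category_n_Dom)
  show ?thesis
  proof
    fix X :: "'a s2t" assume "X \<in> Obj s2t_Gp"
    then interpret pointed_s2t X by unfold_locales simp
    show "omap K_functor X \<in> Obj n_Dom" by (simp add: neardomain_K)
    show "amap K_functor X X (Ident s2t_Gp X) = Ident n_Dom (omap K_functor X)" by simp
  next
    fix X Y :: "'a s2t" and p assume "X \<in> Obj s2t_Gp" "Y \<in> Obj s2t_Gp" "p \<in> Hom s2t_Gp X Y"
    then interpret two_pointed_s2t X Y by unfold_locales simp_all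
    show "amap K_functor X Y p \<in> Hom n_Dom (omap K_functor X) (omap K_functor Y)"
      using bij_betwE[OF bij_betw_amap_K] \<open>p \<in> _\<close> by blast
  next
    fix X Y Z :: "'a s2t" and p q
    show "amap K_functor X Z (Comp s2t_Gp X Y Z q p)
        = Comp n_Dom (omap K_functor X) (omap K_functor Y) (omap K_functor Z)
          (amap K_functor Y Z q) (amap K_functor X Y p)"
      by (cases p; cases q) (simp add: K_functor_def)
  qed
qed


section \<open>The affine group of a nearfield\<close>

lemma subgroup_BijGroupI:
  assumes H: "H \<subseteq> Bij \<Omega>" and id: "(\<lambda>x\<in>\<Omega>. x) \<in> H"
    and comp: "\<And>g h. \<lbrakk>g \<in> H; h \<in> H\<rbrakk> \<Longrightarrow> compose \<Omega> g h \<in> H"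
    and inv: "\<And>g. g \<in> H \<Longrightarrow> \<exists>g'\<in>H. compose \<Omega> g' g = (\<lambda>x\<in>\<Omega>. x)"
  shows "subgroup H (BijGroup \<Omega>)"
proof -
  interpret B: group "BijGroup \<Omega>" by (rule group_BijGroup)
  show ?thesis
  proof (rule B.subgroupI)
    show "H \<subseteq> carrier (BijGroup \<Omega>)" using H by (simp add: BijGroup_def)
    show "H \<noteq> {}" using id by blast
    fix g assume g: "g \<in> H"
    obtain g' where g': "g' \<in> H" "compose \<Omega> g' g = (\<lambda>x\<in>\<Omega>. x)" using inv[OF g] by blast
    have "inv\<^bsub>BijGroup \<Omega>\<^esub> g = g'"
      using g g' H by (intro B.inv_equality) (auto simp: BijGroup_def subsetD)
    then show "inv\<^bsub>BijGroup \<Omega>\<^esub> g \<in> H" using g' by simp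
    fix h assume "h \<in> H"
    then show "g \<otimes>\<^bsub>BijGroup \<Omega>\<^esub> h \<in> H" using g comp H by (auto simp: BijGroup_def subsetD)
  qed
qed

context nearfield
begin

lemma add_assoc:
  assumes "a \<in> carrier R" "b \<in> carrier R" "x \<in> carrier R"
  shows "a \<oplus> (b \<oplus> x) = (a \<oplus> b) \<oplus> x"
proof -
  obtain d where d: "d \<in> carrier R - {\<zero>}" "\<forall>x \<in> carrier R. a \<oplus> (b \<oplus> x) = (a \<oplus> b) \<oplus> d \<otimes> x"
    using weak_assoc assms by blast
  then have "d = \<one>" using d_eq_one assms by blast
  then show ?thesis using d assms by (simp add: one_mult)
qed

definition affine :: "'a \<Rightarrow> 'a \<Rightarrow> 'a \<Rightarrow> 'a"
  where "affine a m = (\<lambda>x \<in> carrier R. a \<oplus> m \<otimes> x)"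

definition affine_group :: "('a \<Rightarrow> 'a) set"
  where "affine_group = {affine a m | a m. a \<in> carrier R \<and> m \<in> carrier R - {\<zero>}}"

definition affine_object :: "'a s2t"
  where "affine_object = \<lparr>Grp = affine_group, Pts = carrier R, base0 = \<zero>, base1 = \<one>\<rparr>"

lemma affine_object_simps [simp]:
  "Grp affine_object = affine_group" "Pts affine_object = carrier R"
  "base0 affine_object = \<zero>" "base1 affine_object = \<one>"
  by (simp_all add: affine_object_def)

lemma affine_eq: "x \<in> carrier R \<Longrightarrow> affine a m x = a \<oplus> m \<otimes> x"
  by (simp add: affine_def)

lemma affine_closed:
  "\<lbrakk>a \<in> carrier R; m \<in> carrier R; x \<in> carrier R\<rbrakk> \<Longrightarrow> affine a m x \<in> carrier R"
  by (simp add: affine_eq add_closed mult_closed)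

lemma affine_in_group: "\<lbrakk>a \<in> carrier R; m \<in> carrier R; m \<noteq> \<zero>\<rbrakk> \<Longrightarrow> affine a m \<in> affine_group"
  unfolding affine_group_def by blast

lemma affine_groupE:
  assumes "g \<in> affine_group"
  obtains a m where "g = affine a m" "a \<in> carrier R" "m \<in> carrier R" "m \<noteq> \<zero>"
  using assms unfolding affine_group_def by blast

lemma affine_id: "affine \<zero> \<one> = (\<lambda>x \<in> carrier R. x)"
  by (auto simp: affine_def one_mult l_zero)

lemma affine_compose:
  assumes "a \<in> carrier R" "m \<in> carrier R" "b \<in> carrier R" "n \<in> carrier R"
  shows "compose (carrier R) (affine a m) (affine b n) = affine (a \<oplus> m \<otimes> b) (m \<otimes> n)"
  using assms
  by (auto simp: compose_def affine_def add_closed mult_closed distrib mult_assoc add_assoc)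

lemma affine_agree:
  assumes "a \<in> carrier R" "m \<in> carrier R" "b \<in> carrier R" "n \<in> carrier R"
    and "affine a m \<zero> = affine b n \<zero>" "affine a m \<one> = affine b n \<one>"
  shows "a = b" "m = n"
proof -
  show ab: "a = b" using assms by (simp add: affine_eq zero_closed mult_zero r_zero)
  show "m = n" using assms(6) add_cancel[of a m n] assms(1-4)
    by (simp add: ab affine_eq one_closed mult_one)
qed

lemma affine_inverse:
  assumes a: "a \<in> carrier R" and m: "m \<in> carrier R" "m \<noteq> \<zero>"
  obtains b n where "b \<in> carrier R" "n \<in> carrier R" "n \<noteq> \<zero>"
    "compose (carrier R) (affine b n) (affine a m) = (\<lambda>x \<in> carrier R. x)"
    "compose (carrier R) (affine a m) (affine b n) = (\<lambda>x \<in> carrier R. x)"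
proof -
  obtain n where n: "n \<in> carrier R" "n \<noteq> \<zero>" "m \<otimes> n = \<one>" "n \<otimes> m = \<one>"
    using mult_inverse[OF m] .
  obtain c where c: "c \<in> carrier R" "a \<oplus> c = \<zero>" using add_solve[OF a zero_closed] by blast
  have ca: "c \<oplus> a = \<zero>" using add_zero_commute[OF a c] .
  let ?b = "n \<otimes> c"
  have "?b \<oplus> n \<otimes> a = \<zero>" using distrib[OF n(1) c(1) a] ca n by (simp add: mult_zero)
  moreover have "a \<oplus> m \<otimes> ?b = \<zero>"
    using mult_assoc[OF m(1) n(1) c(1)] c n by (simp add: one_mult)
  ultimately show ?thesis
    using that[of ?b n] a m n c by (simp add: mult_closed affine_compose affine_id)
qed

lemma affine_Bij:
  assumes "a \<in> carrier R" "m \<in> carrier R" "m \<noteq> \<zero>"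
  shows "affine a m \<in> Bij (carrier R)"
proof -
  obtain b n where bn: "b \<in> carrier R" "n \<in> carrier R" "n \<noteq> \<zero>"
    "compose (carrier R) (affine b n) (affine a m) = (\<lambda>x \<in> carrier R. x)"
    "compose (carrier R) (affine a m) (affine b n) = (\<lambda>x \<in> carrier R. x)"
    using affine_inverse[OF assms] .
  have "bij_betw (affine a m) (carrier R) (carrier R)"
  proof (rule bij_betwI)
    show "affine a m \<in> carrier R \<rightarrow> carrier R" "affine b n \<in> carrier R \<rightarrow> carrier R"
      using assms bn by (auto simp: affine_closed)
    fix x assume x: "x \<in> carrier R"
    show "affine b n (affine a m x) = x" using fun_cong[OF bn(4), of x] x by (simp add: compose_eq)
    show "affine a m (affine b n x) = x" using fun_cong[OF bn(5), of x] x by (simp add: compose_eq)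
  qed
  then show ?thesis by (simp add: Bij_def affine_def)
qed

lemma subgroup_affine_group: "subgroup affine_group (BijGroup (carrier R))"
proof (rule subgroup_BijGroupI)
  show "affine_group \<subseteq> Bij (carrier R)" by (auto elim!: affine_groupE intro: affine_Bij)
  show "(\<lambda>x \<in> carrier R. x) \<in> affine_group"
    using affine_in_group[OF zero_closed one_closed one_not_zero] by (simp add: affine_id)
next
  fix g h assume "g \<in> affine_group" "h \<in> affine_group"
  then show "compose (carrier R) g h \<in> affine_group"
    by (elim affine_groupE)
      (simp add: affine_compose affine_in_group add_closed mult_closed mult_nonzero)
next
  fix g assume "g \<in> affine_group"
  then obtain a m where am: "g = affine a m" "a \<in> carrier R" "m \<in> carrier R" "m \<noteq> \<zero>"
    by (rule affine_groupE)
  obtain b n where bn: "b \<in> carrier R" "n \<in> carrier R" "n \<noteq> \<zero>"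
    "compose (carrier R) (affine b n) (affine a m) = (\<lambda>x \<in> carrier R. x)"
    using affine_inverse[OF am(2-4)] by metis
  then show "\<exists>g' \<in> affine_group. compose (carrier R) g' g = (\<lambda>x \<in> carrier R. x)"
    using affine_in_group am by blast
qed

lemma affine_group_agree:
  assumes "g \<in> affine_group" "h \<in> affine_group" "g \<zero> = h \<zero>" "g \<one> = h \<one>"
  shows "g = h"
  using assms affine_agree by (elim affine_groupE) metis

text \<open>As \<open>affine_group\<close> is a group, 2-transitivity reduces to reaching every pair from \<open>(\<zero>, \<one>)\<close>.\<close>

lemma affine_group_base_pair:
  assumes "\<alpha> \<in> carrier R" "\<beta> \<in> carrier R" "\<alpha> \<noteq> \<beta>"
  obtains g where "g \<in> affine_group" "g \<zero> = \<alpha>" "g \<one> = \<beta>"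
proof -
  obtain m where m: "m \<in> carrier R" "\<alpha> \<oplus> m = \<beta>" using add_solve assms by blast
  then have "m \<noteq> \<zero>" using assms r_zero by auto
  then show ?thesis
    using that[of "affine \<alpha> m"] affine_in_group m assms
    by (simp add: affine_eq zero_closed one_closed mult_zero mult_one r_zero)
qed

lemma s2t_group_affine_group: "s2t_group affine_group (carrier R)"
proof (rule s2t_group.intro)
  show "subgroup affine_group (BijGroup (carrier R))" by (rule subgroup_affine_group)
  show "\<exists>\<alpha>\<in>carrier R. \<exists>\<beta>\<in>carrier R. \<alpha> \<noteq> \<beta>" using zero_closed one_closed one_not_zero by blast
  fix \<alpha>1 \<alpha>2 \<beta>1 \<beta>2
  assume \<alpha>: "\<alpha>1 \<in> carrier R" "\<alpha>2 \<in> carrier R" and \<beta>: "\<beta>1 \<in> carrier R" "\<beta>2 \<in> carrier R"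
    and ne: "\<alpha>1 \<noteq> \<alpha>2" "\<beta>1 \<noteq> \<beta>2"
  obtain p where p: "p \<in> affine_group" "p \<zero> = \<alpha>1" "p \<one> = \<alpha>2"
    using affine_group_base_pair[OF \<alpha> ne(1)] .
  obtain q where q: "q \<in> affine_group" "q \<zero> = \<beta>1" "q \<one> = \<beta>2"
    using affine_group_base_pair[OF \<beta> ne(2)] .
  have comp: "compose (carrier R) g h \<in> affine_group" if "g \<in> affine_group" "h \<in> affine_group" for g h
    using subgroup.m_closed[OF subgroup_affine_group that] that
      subgroup.subset[OF subgroup_affine_group] by (auto simp: BijGroup_def subsetD)
  obtain p' where p': "p' \<in> affine_group" "compose (carrier R) p' p = (\<lambda>x \<in> carrier R. x)"
    "compose (carrier R) p p' = (\<lambda>x \<in> carrier R. x)"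
    using p(1) affine_inverse affine_in_group by (metis affine_groupE)
  have p'p: "p' (p x) = x" "p (p' x) = x" if "x \<in> carrier R" for x
    using fun_cong[OF p'(2), of x] fun_cong[OF p'(3), of x] that by (simp_all add: compose_eq)
  have "p' \<alpha>1 = \<zero>" "p' \<alpha>2 = \<one>" using p'p(1)[OF zero_closed] p'p(1)[OF one_closed] p by simp_all
  then have ex: "compose (carrier R) q p' \<in> affine_group"
    "compose (carrier R) q p' \<alpha>1 = \<beta>1" "compose (carrier R) q p' \<alpha>2 = \<beta>2"
    using comp[OF q(1) p'(1)] q \<alpha> by (simp_all add: compose_eq)
  have unique: "g = h"
    if g: "g \<in> affine_group" "g \<alpha>1 = \<beta>1" "g \<alpha>2 = \<beta>2"
      and h: "h \<in> affine_group" "h \<alpha>1 = \<beta>1" "h \<alpha>2 = \<beta>2" for g h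
  proof -
    have eq: "compose (carrier R) g p = compose (carrier R) h p"
      using g h p comp
      by (intro affine_group_agree) (simp_all add: compose_eq zero_closed one_closed)
    have Bij: "f \<in> Bij (carrier R)" if "f \<in> affine_group" for f
      using subgroup.subset[OF subgroup_affine_group] that by (auto simp: BijGroup_def)
    show "g = h"
    proof (rule extensionalityI)
      show "g \<in> extensional (carrier R)" "h \<in> extensional (carrier R)"
        using Bij g h by (auto simp: Bij_def)
      fix x assume x: "x \<in> carrier R"
      have "p' x \<in> carrier R" using Bij[OF p'(1)] x by (auto simp: Bij_def dest: bij_betwE)
      then show "g x = h x" using fun_cong[OF eq, of "p' x"] p'p(2)[OF x] by (simp add: compose_eq)
    qed
  qed
  show "\<exists>!g. g \<in> affine_group \<and> g \<alpha>1 = \<beta>1 \<and> g \<alpha>2 = \<beta>2"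
    using ex unique by blast
qed

lemma s2t_object_affine_object: "s2t_object affine_object"
  by (simp add: s2t_object_def s2t_group_affine_group zero_closed one_closed one_not_zero[symmetric])

end

sublocale nearfield \<subseteq> aff: pointed_s2t "affine_object"
  by unfold_locales (rule s2t_object_affine_object)

context nearfield
begin

text \<open>
  A reflection \<open>t : x \<mapsto> a + m x\<close> has \<open>m m = \<one>\<close>. Its linear part \<open>s : x \<mapsto> m x\<close> is again a
  reflection: for \<open>m \<noteq> \<one>\<close> it is an involution, for \<open>m = \<one>\<close> in characteristic 2 it is the identity,
  and for \<open>m = \<one>\<close> otherwise the involution \<open>t\<close> has a fixpoint, which forces \<open>a = \<zero>\<close> and \<open>t = s\<close>.
  Since \<open>s\<close> fixes \<open>\<zero>\<close>, it is the base reflection, and \<open>t s\<close> is the translation by \<open>a\<close>.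
\<close>

lemma reflection_translates:
  assumes t: "t \<in> aff.reflections" and x: "x \<in> carrier R"
  shows "t (aff.\<nu> x) = t \<zero> \<oplus> x"
proof -
  note reflections = aff.reflections_def[simplified]
  have "t \<in> affine_group" using aff.reflection_in[OF t] by simp
  then obtain a m where am: "t = affine a m" "a \<in> carrier R" "m \<in> carrier R" "m \<noteq> \<zero>"
    by (rule affine_groupE)
  have "compose (carrier R) t t = affine \<zero> \<one>"
    using aff.reflection_twice[OF t] by (auto simp: affine_id compose_def)
  then have eq: "affine (a \<oplus> m \<otimes> a) (m \<otimes> m) = affine \<zero> \<one>"
    using am by (simp add: affine_compose)
  then have mm: "m \<otimes> m = \<one>"
    using affine_agree(2)[of "a \<oplus> m \<otimes> a" "m \<otimes> m" \<zero> \<one>] am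
    by (simp add: add_closed mult_closed zero_closed one_closed)
  define s where "s = affine \<zero> m"
  have s_eq: "s y = m \<otimes> y" if "y \<in> carrier R" for y
    using that am by (simp add: s_def affine_eq l_zero mult_closed)
  have sG: "s \<in> affine_group" using am affine_in_group zero_closed by (simp add: s_def)
  have ss: "s (s y) = y" if "y \<in> carrier R" for y
    using that am mult_assoc[of m m y] mm by (simp add: s_eq mult_closed one_mult)
  have "s \<in> aff.reflections"
  proof (cases "m = \<one>")
    case False
    then have "s \<one> \<noteq> \<one>" using s_eq[OF one_closed] am by (simp add: mult_one)
    then have "s \<in> aff.J" using sG ss one_closed aff.involution_iff[of s] by auto
    then show ?thesis by (simp add: reflections)
  next
    case True
    then have s: "s = (\<lambda>x \<in> carrier R. x)" by (simp add: s_def affine_id)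
    show ?thesis
    proof (cases "char2 affine_group (carrier R)")
      case c: True
      then show ?thesis using s by (simp add: reflections)
    next
      case c: False
      then have tJ: "t \<in> aff.J" using t by (simp add: reflections)
      obtain y where y: "y \<in> carrier R" "t y = y" using aff.fixpoint_exists[OF _ tJ] c by auto
      then have "a \<oplus> y = \<zero> \<oplus> y" using am True by (simp add: affine_eq one_mult l_zero)
      then have "a = \<zero>" using add_cancel_right am y zero_closed by blast
      then have "t = s" using am True by (simp add: s_def)
      then show ?thesis using t by simp
    qed
  qed
  moreover have "s \<zero> = \<zero>" using s_eq[OF zero_closed] am by (simp add: mult_zero)
  ultimately have "s = aff.\<nu>" using aff.\<nu>_unique by simp
  then have "t (aff.\<nu> x) = a \<oplus> m \<otimes> (m \<otimes> x)"
    using s_eq[OF x] am x by (simp add: affine_eq mult_closed)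
  also have "\<dots> = t \<zero> \<oplus> x"
    using mult_assoc[of m m x] am x mm
    by (simp add: one_mult affine_eq zero_closed mult_zero r_zero)
  finally show ?thesis .
qed

lemma K_affine_object: "omap K_functor affine_object = R"
proof -
  have plus: "plus0 affine_object = add R"
  proof (rule extensionalityI)
    show "plus0 affine_object \<in> extensional (carrier R)" by (simp add: plus0_def)
    show "add R \<in> extensional (carrier R)" using add_map by (simp add: PiE_def)
    fix a assume a: "a \<in> carrier R"
    show "plus0 affine_object a = add R a"
    proof (rule extensionalityI)
      show "plus0 affine_object a \<in> extensional (carrier R)" using a by (simp add: plus0_def)
      show "add R a \<in> extensional (carrier R)" using add_map a by (auto simp: PiE_def)
      fix b assume b: "b \<in> carrier R"
      obtain t where t: "t \<in> aff.reflections" "t \<zero> = a"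
        using aff.reflection_from_base[of a] a by auto
      show "plus0 affine_object a b = a \<oplus> b"
        using aff.plus0_eq[OF t(1), of b] reflection_translates[OF t(1) b] t b by simp
    qed
  qed
  have times: "times1 affine_object = mult R"
  proof (rule extensionalityI)
    show "times1 affine_object \<in> extensional (carrier R)" by (simp add: times1_def)
    show "mult R \<in> extensional (carrier R)" using mult_map by (simp add: PiE_def)
    fix a assume a: "a \<in> carrier R"
    show "times1 affine_object a = mult R a"
    proof (rule extensionalityI)
      show "times1 affine_object a \<in> extensional (carrier R)" using a by (simp add: times1_def)
      show "mult R a \<in> extensional (carrier R)" using mult_map a by (auto simp: PiE_def)
      fix b assume b: "b \<in> carrier R"
      show "times1 affine_object a b = a \<otimes> b"
      proof (cases "a = \<zero>")
        case True
        then show ?thesis using aff.times1_zero[of b] b by (simp add: zero_mult)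
      next
        case False
        then have "affine \<zero> a \<in> affine_group" using a affine_in_group zero_closed by blast
        then show ?thesis
          using aff.times1_eq[of "affine \<zero> a" b] a b
          by (simp add: affine_eq zero_closed one_closed mult_zero mult_one l_zero mult_closed)
      qed
    qed
  qed
  show ?thesis by (rule ring.equality) (simp_all add: plus times)
qed

text \<open>Regularity of the reflections provides every translation.\<close>

lemma A_set_affine_object: "A_set affine_object = (\<lambda>a. affine a \<one>) ` carrier R"
proof -
  have eq: "compose (carrier R) t aff.\<nu> = affine (t \<zero>) \<one>" if "t \<in> aff.reflections" for t
    using reflection_translates[OF that] by (auto simp: compose_def affine_def one_mult)
  have "(\<lambda>t. t \<zero>) ` aff.reflections = carrier R"
  proof (intro equalityI subsetI)
    fix a assume "a \<in> (\<lambda>t. t \<zero>) ` aff.reflections"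
    then show "a \<in> carrier R" using aff.closed[OF aff.reflection_in] zero_closed by auto
  next
    fix a assume "a \<in> carrier R"
    then obtain t where "t \<in> aff.reflections" "t \<zero> = a"
      using aff.reflection_from_base[of a] by auto
    then show "a \<in> (\<lambda>t. t \<zero>) ` aff.reflections" by blast
  qed
  then have "(\<lambda>a. affine a \<one>) ` carrier R
      = (\<lambda>a. affine a \<one>) ` (\<lambda>t. t \<zero>) ` aff.reflections"
    by simp
  also have "\<dots> = (\<lambda>t. affine (t \<zero>) \<one>) ` aff.reflections" by (rule image_image)
  also have "\<dots> = A_set affine_object" by (simp add: aff.A_set_eq eq)
  finally show ?thesis by simp
qed

lemma subgroup_A_set_affine_object:
  "subgroup (A_set affine_object) (grp_of affine_group (carrier R))"
proof -
  let ?T = "(\<lambda>a. affine a \<one>) ` carrier R"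
  have comp: "compose (carrier R) (affine a \<one>) (affine b \<one>) = affine (a \<oplus> b) \<one>"
    if "a \<in> carrier R" "b \<in> carrier R" for a b
    using that by (simp add: affine_compose one_closed one_mult)
  have "subgroup ?T (BijGroup (carrier R))"
  proof (rule subgroup_BijGroupI)
    show "?T \<subseteq> Bij (carrier R)" using affine_Bij one_closed one_not_zero by blast
    show "(\<lambda>x \<in> carrier R. x) \<in> ?T" using zero_closed affine_id by (metis image_eqI)
  next
    fix g h assume "g \<in> ?T" "h \<in> ?T"
    then show "compose (carrier R) g h \<in> ?T" by (auto simp: comp add_closed)
  next
    fix g assume "g \<in> ?T"
    then obtain a where a: "a \<in> carrier R" "g = affine a \<one>" by blast
    obtain b where b: "b \<in> carrier R" "a \<oplus> b = \<zero>" using add_solve[OF a(1) zero_closed] by blast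
    then have "compose (carrier R) (affine b \<one>) g = (\<lambda>x \<in> carrier R. x)"
      using a comp add_zero_commute affine_id by simp
    then show "\<exists>g' \<in> ?T. compose (carrier R) g' g = (\<lambda>x \<in> carrier R. x)" using b by blast
  qed
  moreover have "?T \<subseteq> affine_group" using affine_in_group one_closed one_not_zero by blast
  ultimately show ?thesis
    unfolding A_set_affine_object grp_of_def
    using group.subgroup_incl[OF group_BijGroup _ subgroup_affine_group] by blast
qed

end

lemma bij_betw_omap_K: "bij_betw (omap K_functor) (Obj (s2t_Gp_A :: ('a s2t, _) cat)) (Obj n_Fld)"
proof (rule bij_betw_imageI)
  show "inj_on (omap K_functor) (Obj (s2t_Gp_A :: ('a s2t, _) cat))"
  proof (rule inj_onI)
    fix X Y :: "'a s2t"
    assume XY: "X \<in> Obj s2t_Gp_A" "Y \<in> Obj s2t_Gp_A" and eq: "omap K_functor X = omap K_functor Y"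
    then interpret two_pointed_s2t X Y by unfold_locales (simp_all add: s2t_Gp_A_def)
    show "X = Y" using K_object_determined eq by simp
  qed
  show "omap K_functor ` Obj (s2t_Gp_A :: ('a s2t, _) cat) = Obj n_Fld"
  proof (intro equalityI subsetI)
    fix R assume "R \<in> omap K_functor ` Obj (s2t_Gp_A :: ('a s2t, _) cat)"
    then obtain X :: "'a s2t" where X: "s2t_object X" "subgroup (A_set X) (grp_of (Grp X) (Pts X))"
      "R = omap K_functor X" by (auto simp: s2t_Gp_A_def)
    then interpret pointed_s2t X by unfold_locales
    show "R \<in> Obj n_Fld" using nearfield_K neardomain_K X by (simp add: n_Fld_def)
  next
    fix R :: "'a ring" assume "R \<in> Obj n_Fld"
    then interpret nearfield R by (simp add: n_Fld_def)
    show "R \<in> omap K_functor ` Obj s2t_Gp_A"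
      using s2t_object_affine_object subgroup_A_set_affine_object K_affine_object
      by (intro image_eqI[of _ _ affine_object]) (simp_all add: s2t_Gp_A_def)
  qed
qed

theorem theorem4p3:
  shows "is_functor (s2t_Gp :: ('a s2t, _) cat) n_Dom K_functor \<and>
    is_equivalence (s2t_Gp_A :: ('a s2t, _) cat) n_Fld K_functor"
proof
  show K: "is_functor (s2t_Gp :: ('a s2t, _) cat) n_Dom K_functor" by (rule is_functor_K)
  show "is_equivalence (s2t_Gp_A :: ('a s2t, _) cat) n_Fld K_functor"
  proof (rule is_equivalence_if_bijective)
    show "is_functor (s2t_Gp_A :: ('a s2t, _) cat) n_Fld K_functor"
      unfolding s2t_Gp_A_def n_Fld_def
    proof (rule is_functor_full_subcat[OF K])
      fix X :: "'a s2t"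
      assume X: "X \<in> Obj s2t_Gp" "subgroup (A_set X) (grp_of (Grp X) (Pts X))"
      then interpret pointed_s2t X by unfold_locales simp
      show "nearfield (omap K_functor X)" using nearfield_K X by blast
    qed
    show "bij_betw (omap K_functor) (Obj (s2t_Gp_A :: ('a s2t, _) cat)) (Obj n_Fld)"
      by (rule bij_betw_omap_K)
  next
    fix X Y :: "'a s2t" assume "X \<in> Obj s2t_Gp_A" "Y \<in> Obj s2t_Gp_A"
    then interpret two_pointed_s2t X Y by unfold_locales (simp_all add: s2t_Gp_A_def)
    show "bij_betw (amap K_functor X Y) (Hom s2t_Gp_A X Y)
        (Hom n_Fld (omap K_functor X) (omap K_functor Y))"
      using bij_betw_amap_K by (simp add: s2t_Gp_A_def n_Fld_def)
  qed
qed

end
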